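(* Let $n\ge 7$ and let $\mathcal{L}=\mathcal{A}-3(n-3)\mathcal{I}$ be the classical Laplacian of the Johnson graph $\Gamma(n,3,2)$. Then $\mathcal{L}$ has a diagonal form whose diagonal entries are exactly the following (with multiplicities added together when the same integer occurs more than once in the list): (1) $3(n-2)$ with multiplicity $\binom{n}{3}-2\binom{n}{2}+n$; (2) $6(n-2)(n-1)$ with multiplicity $\binom{n}{2}-2n+1$; (3) $1$ with multiplicity $\binom{n}{2}-2n+2$; (4) if $n$ is odd: $6(n-2)(n-1)n$ with multiplicity $n-2$, and $1$ with multiplicity $2(n-2)$; (5) if $n$ is even: $\frac32(n-2)(n-1)n$ with multiplicity $n-2$, and $2$ with multiplicity $2(n-2)$; (6) if $n\equiv 2\pmod 3$: $36$ with multiplicity $1$ and $1$ with multiplicity $1$; (7) if $n\not\equiv 2\pmod 3$: $12$ with multiplicity $1$ and $3$ with multiplicity $1$; (8) $0$ with multiplicity $1$.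
   Context: The graph $\Gamma(n,k,\ell)$ has as vertices the $k$-element subsets of $\{1,\dots,n\}$, two of them adjacent when they intersect in exactly $\ell$ elements; $\mathcal{A}$ denotes its adjacency matrix and $\mathcal{I}$ the identity matrix of the same size. For $k=3,\ell=2$ every vertex has degree $d=3(n-3)$, and the classical Laplacian is taken to be $\mathcal{A}-d\mathcal{I}$. A unimodular matrix is a square integer matrix with an integer inverse. A diagonal form of an integer matrix $M$ is a matrix $D$ of the same dimensions as $M$, with $(i,j)$-entry $0$ unless $i=j$, such that $EMF=D$ for some unimodular matrices $E,F$. *)

theory Defs
  imports Main "HOL-Library.Multiset" "Jordan_Normal_Form.Matrix"
begin

definition Gamma_verts :: "nat \<Rightarrow> nat \<Rightarrow> nat set set" where
  "Gamma_verts n k = {S. S \<subseteq> {1..n} \<and> card S = k}"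

text \<open>The condition \<open>S \<noteq> T\<close> is implied by the other one when \<open>\<ell> < k\<close>; it keeps the graph
  loopless in general.\<close>

definition Gamma_adj :: "nat \<Rightarrow> nat \<Rightarrow> nat \<Rightarrow> nat set \<Rightarrow> nat set \<Rightarrow> bool" where
  "Gamma_adj n k l S T \<longleftrightarrow>
     S \<in> Gamma_verts n k \<and> T \<in> Gamma_verts n k \<and> S \<noteq> T \<and> card (S \<inter> T) = l"

text \<open>A matrix indexed by the vertices requires an order on them: \<open>vs\<close> lists every vertex
  exactly once, and row and column \<open>i\<close> belong to \<open>vs ! i\<close>.\<close>

definition Gamma_enum :: "nat \<Rightarrow> nat \<Rightarrow> nat set list \<Rightarrow> bool" where
  "Gamma_enum n k vs \<longleftrightarrow> distinct vs \<and> set vs = Gamma_verts n k"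

definition Gamma_adj_mat :: "nat \<Rightarrow> nat \<Rightarrow> nat \<Rightarrow> nat set list \<Rightarrow> int mat" where
  "Gamma_adj_mat n k l vs =
     mat (length vs) (length vs) (\<lambda>(i, j). if Gamma_adj n k l (vs ! i) (vs ! j) then 1 else 0)"

text \<open>The classical Laplacian of \<open>\<Gamma>(n,3,2)\<close>, with the sign convention \<open>\<A> - d\<I>\<close>.\<close>

definition johnson3_laplacian :: "nat \<Rightarrow> nat set list \<Rightarrow> int mat" where
  "johnson3_laplacian n vs =
     Gamma_adj_mat n 3 2 vs - (3 * (int n - 3)) \<cdot>\<^sub>m 1\<^sub>m (length vs)"

text \<open>The type \<open>int mat\<close> forces the inverse in \<^const>\<open>invertible_mat\<close> to be an integer matrix.\<close>

definition unimodular_mat :: "int mat \<Rightarrow> bool" where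
  "unimodular_mat U \<longleftrightarrow> invertible_mat U"

definition diagonal_form :: "int mat \<Rightarrow> int mat \<Rightarrow> bool" where
  "diagonal_form M D \<longleftrightarrow>
     D \<in> carrier_mat (dim_row M) (dim_col M) \<and> diagonal_mat D \<and>
     (\<exists>E F. E \<in> carrier_mat (dim_row M) (dim_row M) \<and> F \<in> carrier_mat (dim_col M) (dim_col M) \<and>
            unimodular_mat E \<and> unimodular_mat F \<and> E * M * F = D)"

end

theory Submission
  imports Defs "HOL-Library.Function_Algebras" "Jordan_Normal_Form.Determinant"
begin

text \<open>
Integer vectors indexed by the vertices are functions on the triples \<open>T \<subseteq> {1..n}\<close>; the Laplacian
\<open>L\<close> becomes an endomorphism \<open>Lap\<close> of this lattice. A diagonal form with entries \<open>d\<^sub>i\<close> amounts to two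
integral bases with \<open>L e\<^sub>i = d\<^sub>i f\<^sub>i\<close>, and a family of the right size is a basis as soon as it spans
(\<open>diagonal_form_if_has_diagonal\<close>). Spanning is checked on the generators of a decomposition of the
lattice, so bases may be chosen summand by summand (\<open>has_diagonal_Un\<close>, \<open>has_diagonal_UN\<close>).

Let \<open>x S\<close> be the indicator function of the triples that contain \<open>S\<close>. For \<open>S\<close> of size \<open>k\<close>,
\<open>L (x S) = (4 - k) (\<Sum>a\<in>S. x (S - {a})) - k (n + 1 - k) x S\<close> (\<open>Lap_x\<close>), so \<open>L\<close> is triangular with
respect to \<open>k\<close>, with diagonal entries \<open>0\<close>, \<open>-n\<close>, \<open>-b\<close>, \<open>-c\<close> for \<open>b = 2 (n - 1)\<close> and \<open>c = 3 (n - 2)\<close>.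
Adding \<open>k (n + 1 - k)\<close> leaves an operator that lowers \<open>k\<close> by one. The point is that the lattice
is a direct sum of \<open>L\<close>-invariant chains that this lowering operator traverses, with integer
multipliers that do not depend on \<open>n\<close>:
\<^item> one chain \<open>e\<^sub>3 \<rightarrow> 3 e\<^sub>2\<close>, \<open>e\<^sub>2 \<rightarrow> 4 x {3}\<close>, \<open>x {3} \<rightarrow> 3 x {}\<close>, \<open>x {} \<rightarrow> 0\<close>;
\<^item> for each of the \<open>n - 2\<close> points \<open>a\<close> of \<open>A = {1..n - 1} - {3}\<close> a chain \<open>t a \<rightarrow> 2 q a\<close>,
  \<open>q a \<rightarrow> 2 r a\<close>, \<open>r a \<rightarrow> 0\<close>;
\<^item> for each pair \<open>S \<subseteq> A\<close> except \<open>{1, 2}\<close> and \<open>{4, 5}\<close> a chain \<open>g S \<rightarrow> p S\<close>, \<open>p S \<rightarrow> 0\<close>;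
\<^item> an eigenvector \<open>h T\<close> for each of the remaining triples \<open>T \<subseteq> A\<close>.

Each chain is a bidiagonal matrix of size at most four, diagonalised by hand: the second kind gives
\<open>1, 1, nbc\<close> when \<open>n\<close> is odd and \<open>2, 2, nbc/4\<close> when \<open>n\<close> is even, since then all its entries are even;
the first kind gives \<open>36, 1, 1, 0\<close> or \<open>12, 3, 1, 0\<close> according to \<open>n\<close> modulo 3; the third gives
\<open>1, bc\<close> and the last \<open>c\<close> (\<open>has_diagonal_chain4\<close>, \<open>has_diagonal_chain3_odd\<close>,
\<open>has_diagonal_chain3_even\<close>, \<open>has_diagonal_chain2\<close>).

The chains are found as follows. Lowering a pair \<open>{a, b}\<close> gives \<open>2 (x {a} + x {b})\<close>, so only the
vertex degrees of a combination of pairs matter: \<open>e\<^sub>2\<close> has degrees \<open>2\<close> at the point 3, \<open>q a\<close> has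
degrees \<open>1\<close> at \<open>a\<close> and \<open>-1\<close> at 3, and the \<open>p S\<close> have degrees zero. Lowering a triple gives the
boundary triangle. The elements \<open>e\<^sub>3\<close>, \<open>t a\<close>, \<open>g S\<close> solve the equations for the boundary within the
span of the triples \<open>{3, a, b}\<close>, \<open>{4, 5, v}\<close>, \<open>{1, 5, 6}\<close>, \<open>{2, 4, 6}\<close>, and \<open>h T\<close> is \<open>x T\<close> corrected to
have boundary zero. That nothing is missing comes from the linear relations between the \<open>x S\<close>, which express
everything containing \<open>n\<close>, the pair \<open>{1, 2}\<close>, and the triples \<open>{1, 2, j}\<close>, \<open>{1, 4, 6}\<close>, \<open>{2, 5, 6}\<close> by
the other \<open>x S\<close> (\<open>span_vertex\<close>).
\<close>

section \<open>Diagonal forms from two spanning families\<close>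

text \<open>Lattices are written in the ring of integer-valued functions, where an integer acts through
\<open>of_int\<close>; this makes all linear identities instances of ring arithmetic.\<close>

interpretation zmod: Modules.module "\<lambda>(k::int) (v::'v::comm_ring_1). of_int k * v"
  by standard (simp_all add: algebra_simps)

abbreviation zspan :: "'v::comm_ring_1 set \<Rightarrow> 'v set"
  where "zspan \<equiv> zmod.span"

text \<open>For generators \<open>G\<close> of the whole lattice, and \<open>D\<close> of the size of its rank, the two families in the
witness are bases in which \<open>L\<close> is diagonal with entries \<open>D\<close>. Keeping \<open>G\<close> as a parameter lets the bases
be assembled from the summands of a decomposition of the lattice.\<close>

definition has_diagonal :: "('v::comm_ring_1 \<Rightarrow> 'v) \<Rightarrow> 'v set \<Rightarrow> int multiset \<Rightarrow> bool" where
  "has_diagonal L G D \<longleftrightarrow> (\<exists>xs. (\<forall>(e, f, d) \<in> set xs. L e = of_int d * f)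
     \<and> G \<subseteq> zspan ((\<lambda>(e, f, d). e) ` set xs) \<and> G \<subseteq> zspan ((\<lambda>(e, f, d). f) ` set xs)
     \<and> mset (map (\<lambda>(e, f, d). d) xs) = D)"

lemma has_diagonal_Un:
  assumes "has_diagonal L G D" and "has_diagonal L H D'"
  shows "has_diagonal L (G \<union> H) (D + D')"
proof -
  obtain xs where xs: "\<forall>(e, f, d) \<in> set xs. L e = of_int d * f"
      "G \<subseteq> zspan ((\<lambda>(e, f, d). e) ` set xs)" "G \<subseteq> zspan ((\<lambda>(e, f, d). f) ` set xs)"
      "mset (map (\<lambda>(e, f, d). d) xs) = D"
    using assms(1) unfolding has_diagonal_def by blast
  obtain ys where ys: "\<forall>(e, f, d) \<in> set ys. L e = of_int d * f"
      "H \<subseteq> zspan ((\<lambda>(e, f, d). e) ` set ys)" "H \<subseteq> zspan ((\<lambda>(e, f, d). f) ` set ys)"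
      "mset (map (\<lambda>(e, f, d). d) ys) = D'"
    using assms(2) unfolding has_diagonal_def by blast
  have "zspan X \<subseteq> zspan (X \<union> Y)" "zspan Y \<subseteq> zspan (X \<union> Y)" for X Y :: "'a set"
    by (auto intro: zmod.span_mono[THEN subsetD])
  then have "G \<union> H \<subseteq> zspan ((\<lambda>(e, f, d). e) ` set (xs @ ys))"
      "G \<union> H \<subseteq> zspan ((\<lambda>(e, f, d). f) ` set (xs @ ys))"
    using xs(2,3) ys(2,3) unfolding set_append image_Un by blast+
  then show ?thesis
    using xs(1,4) ys(1,4) unfolding has_diagonal_def
    by (intro exI[of _ "xs @ ys"]) auto
qed

lemma has_diagonal_UN:
  assumes "finite I" and "\<And>i. i \<in> I \<Longrightarrow> has_diagonal L (G i) (D i)"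
  shows "has_diagonal L (\<Union>i\<in>I. G i) (\<Sum>i\<in>I. D i)"
  using assms
proof (induction I)
  case empty
  show ?case by (simp add: has_diagonal_def)
next
  case (insert i I)
  then show ?case
    using has_diagonal_Un[of L "G i" "D i"] by simp
qed

lemma zspan_list:
  assumes "v \<in> zspan (set bs)"
  shows "\<exists>u. v = (\<Sum>j<length bs. of_int (u j) * bs ! j)"
proof -
  let ?T = "{v. \<exists>u. v = (\<Sum>j<length bs. of_int (u j) * bs ! j)}"
  have "zmod.subspace ?T"
  proof (rule zmod.subspaceI)
    show "0 \<in> ?T" by (auto intro!: exI[of _ "\<lambda>_. 0"])
  next
    fix x y assume "x \<in> ?T" "y \<in> ?T"
    then obtain u u' where "x = (\<Sum>j<length bs. of_int (u j) * bs ! j)"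
        "y = (\<Sum>j<length bs. of_int (u' j) * bs ! j)" by auto
    then have "x + y = (\<Sum>j<length bs. of_int (u j + u' j) * bs ! j)"
      by (simp add: sum.distrib algebra_simps)
    then show "x + y \<in> ?T" by (intro CollectI exI[of _ "\<lambda>j. u j + u' j"])
  next
    fix c x assume "x \<in> ?T"
    then obtain u where "x = (\<Sum>j<length bs. of_int (u j) * bs ! j)" by auto
    then have "of_int c * x = (\<Sum>j<length bs. of_int (c * u j) * bs ! j)"
      by (simp only: sum_distrib_left of_int_mult mult.assoc)
    then show "of_int c * x \<in> ?T" by (intro CollectI exI[of _ "\<lambda>j. c * u j"])
  qed
  moreover have "set bs \<subseteq> ?T"
  proof
    fix x assume "x \<in> set bs"
    then obtain i where i: "i < length bs" "x = bs ! i" by (auto simp: in_set_conv_nth)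
    then have "x = (\<Sum>j<length bs. of_int (of_bool (j = i)) * bs ! j)"
      by (simp add: of_bool_def if_distrib if_distribR sum.delta cong: if_cong)
    then show "x \<in> ?T" by (intro CollectI exI[of _ "\<lambda>j. of_bool (j = i)"])
  qed
  ultimately show ?thesis using assms zmod.span_minimal by blast
qed

lemma of_int_fun_apply [simp]: "(of_int k :: 'a \<Rightarrow> 'b::comm_ring_1) x = of_int k"
  by (cases k) simp_all

lemma sum_fun_apply: "(\<Sum>i\<in>I. (f i :: 'a \<Rightarrow> 'b::comm_monoid_add)) x = (\<Sum>i\<in>I. f i x)"
  by (induction I rule: infinite_finite_induct) simp_all

text \<open>Over the field of rationals one-sided inverses of square matrices are two-sided.\<close>

lemma int_mat_left_inverse:
  assumes A: "(A :: int mat) \<in> carrier_mat n n" and B: "B \<in> carrier_mat n n" and AB: "A * B = 1\<^sub>m n"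
  shows "B * A = 1\<^sub>m n"
proof -
  let ?r = "map_mat (of_int :: int \<Rightarrow> rat)"
  have "?r A * ?r B = 1\<^sub>m n"
    using of_int_hom.mat_hom_mult[OF A B, where 'a = rat] AB by (simp add: of_int_hom.mat_hom_one)
  then have "?r B * ?r A = 1\<^sub>m n"
    using A B by (intro mat_mult_left_right_inverse[of "?r A"]) auto
  then have "?r (B * A) = ?r (1\<^sub>m n)"
    using of_int_hom.mat_hom_mult[OF B A, where 'a = rat] by (simp add: of_int_hom.mat_hom_one)
  then show ?thesis by (rule of_int_hom.mat_hom_inj)
qed

text \<open>Writing the unit vectors in terms of the family gives a right inverse with integer entries.\<close>

lemma spanning_family_unimodular:
  fixes bs :: "('a \<Rightarrow> int) list"
  assumes "distinct vs" and len: "length bs = length vs"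
    and span: "\<And>v. v \<in> set vs \<Longrightarrow> (\<lambda>w. of_bool (w = v)) \<in> zspan (set bs)"
  defines "N \<equiv> length vs"
  defines "B \<equiv> mat N N (\<lambda>(i, j). (bs ! j) (vs ! i))"
  shows "\<exists>C \<in> carrier_mat N N. B * C = 1\<^sub>m N \<and> C * B = 1\<^sub>m N"
proof -
  have "\<forall>i<N. \<exists>u. (\<lambda>w. of_bool (w = vs ! i)) = (\<Sum>j<N. of_int (u j) * bs ! j)"
    using span zspan_list[of _ bs] len unfolding N_def by (metis nth_mem)
  then obtain u where u: "(\<lambda>w. of_bool (w = vs ! i)) = (\<Sum>j<N. of_int (u i j) * bs ! j)"
    if "i < N" for i by metis
  define C where "C = mat N N (\<lambda>(j, i). u i j)"
  have "B * C = 1\<^sub>m N"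
  proof (rule eq_matI)
    fix i k assume "i < dim_row (1\<^sub>m N)" "k < dim_col (1\<^sub>m N)"
    then have ik: "i < N" "k < N" by auto
    have "(B * C) $$ (i, k) = (\<Sum>j<N. of_int (u k j) * (bs ! j) (vs ! i))"
      using ik by (auto simp: B_def C_def scalar_prod_def lessThan_atLeast0 intro!: sum.cong)
    also have "\<dots> = (\<Sum>j<N. of_int (u k j) * bs ! j) (vs ! i)"
      by (simp add: sum_fun_apply)
    also have "\<dots> = of_bool (vs ! i = vs ! k)"
      using u[OF ik(2)] by metis
    finally show "(B * C) $$ (i, k) = 1\<^sub>m N $$ (i, k)"
      using ik assms(1) by (simp add: N_def nth_eq_iff_index_eq)
  qed (auto simp: B_def C_def)
  moreover have "B \<in> carrier_mat N N" "C \<in> carrier_mat N N" by (auto simp: B_def C_def)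
  ultimately show ?thesis using int_mat_left_inverse by blast
qed

lemma unimodular_matI:
  assumes "A \<in> carrier_mat n n" "B \<in> carrier_mat n n" "A * B = 1\<^sub>m n" "B * A = 1\<^sub>m n"
  shows "unimodular_mat A"
  using assms unfolding unimodular_mat_def invertible_mat_def inverts_mat_def by auto

text \<open>With the two families as columns of matrices \<open>B\<close> and \<open>C\<close>, the equations \<open>L e\<^sub>i = d\<^sub>i f\<^sub>i\<close> say
\<open>M B = C D\<close>, and \<open>B\<close>, \<open>C\<close> are unimodular; hence \<open>C\<close> inverse and \<open>B\<close> transform \<open>M\<close> into \<open>D\<close>.\<close>

lemma diagonal_form_if_has_diagonal:
  fixes K :: "'a \<Rightarrow> 'a \<Rightarrow> int"
  assumes dist: "distinct vs" and size: "size Ds = length vs"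
    and diag: "has_diagonal L G Ds"
    and gen: "\<And>v. v \<in> set vs \<Longrightarrow> (\<lambda>w. of_bool (w = v)) \<in> zspan G"
    and L: "\<And>g v. v \<in> set vs \<Longrightarrow> L g v = (\<Sum>w\<in>set vs. K v w * g w)"
  defines "M \<equiv> mat (length vs) (length vs) (\<lambda>(i, j). K (vs ! i) (vs ! j))"
  shows "\<exists>D. diagonal_form M D \<and> mset (diag_mat D) = Ds"
proof -
  obtain xs where xs: "\<forall>(e, f, d) \<in> set xs. L e = of_int d * f"
      "G \<subseteq> zspan ((\<lambda>(e, f, d). e) ` set xs)" "G \<subseteq> zspan ((\<lambda>(e, f, d). f) ` set xs)"
      "mset (map (\<lambda>(e, f, d). d) xs) = Ds"
    using diag unfolding has_diagonal_def by blast
  have len: "length xs = length vs"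
    using arg_cong[OF xs(4), of size] size by simp
  define N where "N = length vs"
  define es fs ds where "es = map (\<lambda>(e, f, d). e) xs" and "fs = map (\<lambda>(e, f, d). f) xs"
    and "ds = map (\<lambda>(e, f, d). d) xs"
  have lens: "length es = N" "length fs = N" "length ds = N"
    using len by (simp_all add: es_def fs_def ds_def N_def)
  define B where "B = mat N N (\<lambda>(i, j). (es ! j) (vs ! i))"
  define C where "C = mat N N (\<lambda>(i, j). (fs ! j) (vs ! i))"
  define D where "D = mat N N (\<lambda>(i, j). if i = j then ds ! i else 0)"
  have "G \<subseteq> zspan (set es)" "G \<subseteq> zspan (set fs)"
    using xs(2,3) unfolding es_def fs_def by auto
  then have span: "zspan G \<subseteq> zspan (set es)" "zspan G \<subseteq> zspan (set fs)"
    by (simp_all add: zmod.span_minimal)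
  obtain B' where B': "B' \<in> carrier_mat N N" "B * B' = 1\<^sub>m N" "B' * B = 1\<^sub>m N"
    using spanning_family_unimodular[OF dist, of es] lens gen span unfolding B_def N_def by blast
  obtain C' where C': "C' \<in> carrier_mat N N" "C * C' = 1\<^sub>m N" "C' * C = 1\<^sub>m N"
    using spanning_family_unimodular[OF dist, of fs] lens gen span unfolding C_def N_def by blast
  have carr: "M \<in> carrier_mat N N" "B \<in> carrier_mat N N" "C \<in> carrier_mat N N" "D \<in> carrier_mat N N"
    by (simp_all add: M_def B_def C_def D_def N_def)
  have "M * B = C * D"
  proof (rule eq_matI)
    fix i j assume "i < dim_row (C * D)" "j < dim_col (C * D)"
    then have ij: "i < N" "j < N" using carr by auto
    have Le: "L (es ! j) = of_int (ds ! j) * fs ! j"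
      using xs(1) ij lens unfolding es_def fs_def ds_def
      by (auto simp: case_prod_beta)
    have "(M * B) $$ (i, j) = (\<Sum>k<N. K (vs ! i) (vs ! k) * (es ! j) (vs ! k))"
      using ij by (auto simp: M_def B_def N_def scalar_prod_def lessThan_atLeast0 intro!: sum.cong)
    also have "\<dots> = (\<Sum>w\<in>set vs. K (vs ! i) w * (es ! j) w)"
      by (rule sum.reindex_bij_betw[OF bij_betw_nth]) (use dist in \<open>simp_all add: N_def\<close>)
    also have "\<dots> = L (es ! j) (vs ! i)"
      using ij by (simp add: L N_def)
    also have "\<dots> = (fs ! j) (vs ! i) * ds ! j"
      by (simp add: Le)
    also have "\<dots> = (\<Sum>k<N. (fs ! k) (vs ! i) * (if k = j then ds ! k else 0))"
      using ij by (simp add: if_distrib sum.delta cong: if_cong)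
    also have "\<dots> = (C * D) $$ (i, j)"
      using ij by (auto simp: C_def D_def scalar_prod_def lessThan_atLeast0 intro!: sum.cong)
    finally show "(M * B) $$ (i, j) = (C * D) $$ (i, j)" .
  qed (use carr in auto)
  have "C' * M * B = C' * (M * B)"
    by (rule assoc_mult_mat[OF C'(1) carr(1,2)])
  also have "\<dots> = C' * C * D"
    unfolding \<open>M * B = C * D\<close> by (rule assoc_mult_mat[OF C'(1) carr(3,4), symmetric])
  also have "\<dots> = D"
    unfolding C'(3) using carr(4) by (rule left_mult_one_mat)
  finally have "C' * M * B = D" .
  moreover have "unimodular_mat C'" "unimodular_mat B"
    by (rule unimodular_matI[OF C'(1) carr(3) C'(3,2)], rule unimodular_matI[OF carr(2) B'])
  moreover have "diagonal_mat D" by (simp add: D_def diagonal_mat_def)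
  ultimately have "diagonal_form M D"
    unfolding diagonal_form_def carrier_matD[OF carr(1)] using carr C'(1) by blast
  moreover have "diag_mat D = ds"
    using lens by (auto simp: diag_mat_def D_def intro!: nth_equalityI)
  then have "mset (diag_mat D) = Ds"
    using xs(4) by (simp add: ds_def)
  ultimately show ?thesis by blast
qed

section \<open>Chains of eigenvalues\<close>

text \<open>Reduces an identity between functions to one between integers.\<close>

lemmas pointwise = fun_eq_iff plus_fun_apply minus_apply uminus_apply times_fun_apply zero_fun_apply
  one_fun_apply numeral_fun_apply of_int_fun_apply

lemma zspan_numeral: "v \<in> zspan B \<Longrightarrow> numeral k * v \<in> zspan B"
  using zmod.span_scale[of v B "numeral k"] by simp

lemmas zspan_intros = zmod.span_add zmod.span_diff zmod.span_neg zmod.span_scale zspan_numeral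

lemma additive_of_int:
  fixes L :: "'v::comm_ring_1 \<Rightarrow> 'v"
  assumes "additive L"
  shows "L (of_int k * v) = of_int k * L v"
proof -
  interpret additive L by fact
  have nat: "L (of_nat m * v) = of_nat m * L v" for m
    by (induction m) (simp_all add: zero add algebra_simps)
  show ?thesis
  proof (cases k)
    case (nonneg m)
    then show ?thesis by (simp add: nat)
  next
    case (neg m)
    have "L (of_int k * v) = L (- (of_nat (Suc m) * v))"
      unfolding neg by (simp only: of_int_minus of_int_of_nat_eq mult_minus_left)
    also have "\<dots> = of_int k * L v"
      unfolding neg minus nat by (simp only: of_int_minus of_int_of_nat_eq mult_minus_left)
    finally show ?thesis .
  qed
qed

lemma additive_numeral:
  fixes L :: "'v::comm_ring_1 \<Rightarrow> 'v"
  assumes "additive L"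
  shows "L (numeral k * v) = numeral k * L v"
  using additive_of_int[OF assms, of "numeral k"] by simp

lemma has_diagonalI:
  assumes "\<And>e f d. (e, f, d) \<in> set xs \<Longrightarrow> L e = of_int d * f"
    and "G \<subseteq> zspan ((\<lambda>(e, f, d). e) ` set xs)" and "G \<subseteq> zspan ((\<lambda>(e, f, d). f) ` set xs)"
    and "mset (map (\<lambda>(e, f, d). d) xs) = D"
  shows "has_diagonal L G D"
  using assms unfolding has_diagonal_def by blast

lemma has_diagonal_eigenvector:
  assumes "L h = - (of_int c * h)"
  shows "has_diagonal L {h} {#c#}"
  by (rule has_diagonalI[of "[(h, - h, c)]"])
     (use assms in \<open>auto intro: zmod.span_base zmod.span_neg[of "- h", simplified]\<close>)

text \<open>The matrix of \<open>L\<close> has determinant \<open>bc\<close> and an entry \<open>1\<close>, so its invariant factors are \<open>1\<close> and \<open>bc\<close>.\<close>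

lemma has_diagonal_chain2:
  fixes L :: "('a \<Rightarrow> int) \<Rightarrow> ('a \<Rightarrow> int)"
  assumes "additive L" and g: "L g = p - of_int c * g" and p: "L p = - (of_int b * p)"
  shows "has_diagonal L {g, p} {#1, b * c#}"
proof (rule has_diagonalI[of "[(g, p - of_int c * g, 1), (of_int b * g + p, - g, b * c)]"])
  interpret additive L by fact
  have "L (of_int b * g + p) = of_int (b * c) * - g"
    unfolding add additive_of_int[OF assms(1)] g p by (simp only: pointwise) (simp add: algebra_simps)
  then show "L e = of_int d * f"
    if "(e, f, d) \<in> set [(g, p - of_int c * g, 1), (of_int b * g + p, - g, b * c)]" for e f d
    using that g by auto
next
  let ?E = "{g, of_int b * g + p}"
  have "g \<in> zspan ?E" by (simp add: zmod.span_base)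
  moreover have "(of_int b * g + p) - of_int b * g \<in> zspan ?E"
    by (intro zspan_intros zmod.span_base) auto
  ultimately show "{g, p} \<subseteq> zspan ((\<lambda>(e, f, d). e) ` set [(g, p - of_int c * g, 1), (of_int b * g + p, - g, b * c)])"
    by simp
next
  let ?F = "{p - of_int c * g, - g}"
  have "- (- g) \<in> zspan ?F" "(p - of_int c * g) - of_int c * (- g) \<in> zspan ?F"
    by (intro zspan_intros zmod.span_base; simp)+
  then show "{g, p} \<subseteq> zspan ((\<lambda>(e, f, d). f) ` set [(g, p - of_int c * g, 1), (of_int b * g + p, - g, b * c)])"
    by simp
qed simp

text \<open>Half of \<open>L\<close> is a chain with multipliers \<open>1\<close>, hence cyclic: it has diagonal form \<open>1, 1, nbc\<close> up to
sign, and doubling it gives the claim.\<close>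

lemma has_diagonal_chain3_even:
  fixes L :: "('a \<Rightarrow> int) \<Rightarrow> ('a \<Rightarrow> int)"
  assumes "additive L" and t: "L t = 2 * q - of_int (2 * c) * t" and q: "L q = 2 * r - of_int (2 * b) * q"
    and r: "L r = - (of_int (2 * n) * r)"
  shows "has_diagonal L {t, q, r} {#2, 2, 2 * n * b * c#}"
proof (rule has_diagonalI)
  interpret additive L by fact
  define y where "y = of_int (b * n) * t + of_int n * q + r"
  define u v where "u = q - of_int c * t" and "v = r - of_int b * q"
  let ?xs = "[(t, u, 2), (q, v, 2), (y, - t, 2 * n * b * c)]"
  have Lt: "L t = of_int 2 * u" and Lq: "L q = of_int 2 * v"
    unfolding u_def v_def t q by (simp_all only: pointwise) (simp_all add: algebra_simps)
  have "L y = of_int (2 * n * b * c) * - t"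
    unfolding y_def add additive_of_int[OF assms(1)] t q r by (simp only: pointwise) (simp add: algebra_simps)
  then show "L e = of_int d * f" if "(e, f, d) \<in> set ?xs" for e f d
    using that Lt Lq by auto
  have "y - of_int (b * n) * t - of_int n * q \<in> zspan {t, q, y}"
    by (intro zspan_intros zmod.span_base) auto
  then show "{t, q, r} \<subseteq> zspan ((\<lambda>(e, f, d). e) ` set ?xs)"
    by (simp add: zmod.span_base y_def)
  have tF: "t \<in> zspan {u, v, - t}"
    using zmod.span_neg[OF zmod.span_base[of "- t" "{u, v, - t}"]] by simp
  then have "u + of_int c * t \<in> zspan {u, v, - t}"
    by (intro zspan_intros) (auto intro: zmod.span_base)
  then have qF: "q \<in> zspan {u, v, - t}" by (simp add: u_def)
  then have "v + of_int b * q \<in> zspan {u, v, - t}"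
    by (intro zspan_intros) (auto intro: zmod.span_base)
  then show "{t, q, r} \<subseteq> zspan ((\<lambda>(e, f, d). f) ` set ?xs)"
    using tF qF by (simp add: v_def)
qed simp

text \<open>Here the determinant \<open>nbc\<close> can be concentrated in one entry: modulo the image of \<open>t\<close>, where \<open>c\<close>
odd makes the quotient free, \<open>n\<close> odd makes the multipliers \<open>2\<close> and \<open>n\<close> coprime.\<close>

lemma has_diagonal_chain3_odd:
  fixes n b c :: int and L :: "('a \<Rightarrow> int) \<Rightarrow> ('a \<Rightarrow> int)"
  assumes "additive L" and t: "L t = 2 * q - of_int c * t" and q: "L q = 2 * r - of_int b * q"
    and r: "L r = - (of_int n * r)" and "odd n" "odd c"
  shows "has_diagonal L {t, q, r} {#1, 1, n * b * c#}"
proof -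
  interpret additive L by fact
  obtain n' where n: "n = 2 * n' + 1" using \<open>odd n\<close> by (rule oddE)
  obtain c' where c: "c = 2 * c' + 1" using \<open>odd c\<close> by (rule oddE)
  \<comment> \<open>\<open>e2\<close> and the first two terms of \<open>e3\<close> come from the Bezout identity \<open>n - 2 n' = 1\<close>; the last
    term of \<open>e3\<close> makes its image divisible by \<open>n b c\<close>\<close>
  define e2 e3 where "e2 = - (of_int n' * q) - r"
    and "e3 = of_int n * q + 2 * r - of_int (n * b * c') * t"
  define u v y where "u = 2 * q - of_int c * t" and "v = of_int (n' * b) * q + r"
    and "y = of_int c' * t - q"
  let ?xs = "[(t, u, 1), (e2, v, 1), (e3, y, n * b * c)]"
  show ?thesis
  proof (rule has_diagonalI)
    note L_simps = add diff minus additive_of_int[OF assms(1)] additive_numeral[OF assms(1)] t q r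
    have "L e2 = of_int 1 * v"
      unfolding e2_def v_def L_simps by (simp only: pointwise) (simp add: n algebra_simps)
    moreover have "L e3 = of_int (n * b * c) * y"
      unfolding e3_def y_def L_simps by (simp only: pointwise) (simp add: c algebra_simps)
    ultimately show "L e = of_int d * f" if "(e, f, d) \<in> set ?xs" for e f d
      using that t by (auto simp: u_def)
    have "e3 + 2 * e2 + of_int (n * b * c') * t \<in> zspan {t, e2, e3}"
      by (intro zspan_intros zmod.span_base) auto
    moreover have "e3 + 2 * e2 + of_int (n * b * c') * t = q"
      unfolding e3_def e2_def by (simp only: pointwise) (simp add: n algebra_simps)
    ultimately have qE: "q \<in> zspan {t, e2, e3}" by simp
    then have "- e2 - of_int n' * q \<in> zspan {t, e2, e3}"
      by (intro zspan_intros) (auto intro: zmod.span_base)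
    then show "{t, q, r} \<subseteq> zspan ((\<lambda>(e, f, d). e) ` set ?xs)"
      using qE by (simp add: zmod.span_base e2_def)
    have "- u - 2 * y \<in> zspan {u, v, y}"
      by (intro zspan_intros zmod.span_base) auto
    moreover have "- u - 2 * y = t" unfolding u_def y_def by (simp only: pointwise) (simp add: c algebra_simps)
    ultimately have tF: "t \<in> zspan {u, v, y}" by simp
    then have "of_int c' * t - y \<in> zspan {u, v, y}"
      by (intro zspan_intros) (auto intro: zmod.span_base)
    then have qF: "q \<in> zspan {u, v, y}" by (simp add: y_def)
    then have "v - of_int (n' * b) * q \<in> zspan {u, v, y}"
      by (intro zspan_intros) (auto intro: zmod.span_base)
    then show "{t, q, r} \<subseteq> zspan ((\<lambda>(e, f, d). f) ` set ?xs)"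
      using tF qF by (simp add: v_def)
  qed simp
qed

text \<open>The integers \<open>t\<close> and \<open>\<tau>\<close> are the binomial coefficients \<open>n - 1\<close> over 2 and \<open>n\<close> over 3. They enter the
basis \<open>F1, F2, F3, s\<close> in which the images of \<open>s, q, r, w\<close> under \<open>L\<close> form a bidiagonal matrix with diagonal
\<open>3, 4, 3, 0\<close>. The off-diagonal entries \<open>-2 (n - 1)\<close> and \<open>-n\<close> decide how the two factors 3 combine: the
matrix has rank 1 modulo 3, apart from \<open>n = 2\<close> modulo 3, where both entries are units and the rank
is 2.\<close>

lemma has_diagonal_chain4:
  fixes n t \<tau> :: int and L :: "('a \<Rightarrow> int) \<Rightarrow> ('a \<Rightarrow> int)"
  assumes "additive L" and s: "L s = 3 * q - of_int (3 * (n - 2)) * s"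
    and q: "L q = 4 * r - of_int (2 * (n - 1)) * q" and r: "L r = 3 * w - of_int n * r"
    and w: "L w = 0"
    and t: "2 * t = (n - 1) * (n - 2)" and \<tau>: "3 * \<tau> = n * t"
  shows "has_diagonal L {s, q, r, w} (if n mod 3 = 2 then {#36, 1, 1, 0#} else {#12, 3, 1, 0#})"
proof -
  interpret additive L by fact
  define F1 F2 F3 where "F1 = q - of_int (n - 2) * s" and "F2 = r - of_int t * s"
    and "F3 = w - of_int \<tau> * s"
  have Ls: "L s = 3 * F1"
    unfolding s F1_def by (simp only: pointwise) (simp add: algebra_simps)
  have Lq: "L q = 4 * F2 - of_int (2 * (n - 1)) * F1"
  proof -
    have "L q - (4 * F2 - of_int (2 * (n - 1)) * F1)
        = of_int (2 * (2 * t) - 2 * ((n - 1) * (n - 2))) * s"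
      unfolding q F1_def F2_def by (simp only: pointwise) (simp add: algebra_simps)
    then show ?thesis unfolding t by simp
  qed
  have Lr: "L r = 3 * F3 - of_int n * F2"
  proof -
    have "L r - (3 * F3 - of_int n * F2) = of_int (3 * \<tau> - n * t) * s"
      unfolding r F2_def F3_def by (simp only: pointwise) (simp add: algebra_simps)
    then show ?thesis unfolding \<tau> by simp
  qed
  note L_simps = add diff minus additive_of_int[OF assms(1)] additive_numeral[OF assms(1)] Ls Lq Lr
  have F_span: "{s, q, r, w} \<subseteq> zspan Y" if "F1 \<in> zspan Y" "F2 \<in> zspan Y" "F3 \<in> zspan Y" "s \<in> zspan Y" for Y
  proof -
    have "F1 + of_int (n - 2) * s \<in> zspan Y" "F2 + of_int t * s \<in> zspan Y" "F3 + of_int \<tau> * s \<in> zspan Y"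
      by (intro zspan_intros that)+
    then show ?thesis using that(4) by (simp add: F1_def F2_def F3_def)
  qed
  \<comment> \<open>in each case a multiple of \<open>s\<close> is added to \<open>q\<close> to make the coefficient of \<open>F1\<close> in its image \<open>0\<close>
    or a unit; what is left concerns \<open>F2\<close> and \<open>F3\<close>, where \<open>3 F3 - n F2\<close> is divisible by 3 if \<open>n\<close> is,
    and otherwise extends to a basis by a Bezout identity for 3 and \<open>n\<close>\<close>
  consider \<nu> where "n = 3 * \<nu>" | \<nu> where "n = 3 * \<nu> + 1" | \<nu> where "n = 3 * \<nu> + 2"
    by atomize_elim presburger
  then show ?thesis
  proof cases
    case (1 \<nu>)
    define u v z y where "u = 4 * F2 - F1" and "v = F3 - of_int \<nu> * F2"
      and "z = q + of_int (2 * \<nu> - 1) * s" and "y = s + 3 * z"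
    let ?xs = "[(r, v, 3), (z, u, 1), (y, F2, 12), (w, s, 0)]"
    have "has_diagonal L {s, q, r, w} {#3, 1, 12, 0#}"
    proof (rule has_diagonalI)
      have "L r = of_int 3 * v"
        unfolding v_def L_simps by (simp only: pointwise) (simp add: 1 algebra_simps)
      moreover have "L z = of_int 1 * u"
        unfolding z_def u_def L_simps by (simp only: pointwise) (simp add: 1 algebra_simps)
      moreover have "L y = of_int 12 * F2"
        unfolding y_def z_def L_simps by (simp only: pointwise) (simp add: 1 algebra_simps)
      ultimately show "L e = of_int d * f" if "(e, f, d) \<in> set ?xs" for e f d
        using that w by auto
      have "y - 3 * z \<in> zspan {r, z, y, w}"
        by (intro zspan_intros zmod.span_base) auto
      then have sE: "s \<in> zspan {r, z, y, w}" by (simp add: y_def)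
      then have "z - of_int (2 * \<nu> - 1) * s \<in> zspan {r, z, y, w}"
        by (intro zspan_intros) (auto intro: zmod.span_base)
      then show "{s, q, r, w} \<subseteq> zspan ((\<lambda>(e, f, d). e) ` set ?xs)"
        using sE by (simp add: zmod.span_base z_def)
      have "4 * F2 - u \<in> zspan {v, u, F2, s}" "v + of_int \<nu> * F2 \<in> zspan {v, u, F2, s}"
        by (intro zspan_intros zmod.span_base; simp)+
      then show "{s, q, r, w} \<subseteq> zspan ((\<lambda>(e, f, d). f) ` set ?xs)"
        using F_span[of "{v, u, F2, s}"] by (simp add: u_def v_def zmod.span_base)
    qed simp
    then show ?thesis using 1 by (simp add: add_mset_commute)
  next
    case (2 \<nu>)
    define u v z where "u = 3 * F3 - of_int n * F2" and "v = F3 - of_int \<nu> * F2"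
      and "z = q + of_int (2 * \<nu>) * s + 4 * r"
    let ?xs = "[(s, F1, 3), (r, u, 1), (z, v, 12), (w, s, 0)]"
    have "has_diagonal L {s, q, r, w} {#3, 1, 12, 0#}"
    proof (rule has_diagonalI)
      have "L r = of_int 1 * u"
        unfolding u_def L_simps by (simp only: pointwise) (simp add: algebra_simps)
      moreover have "L z = of_int 12 * v"
        unfolding z_def v_def L_simps by (simp only: pointwise) (simp add: 2 algebra_simps)
      ultimately show "L e = of_int d * f" if "(e, f, d) \<in> set ?xs" for e f d
        using that w Ls by auto
      have "z - of_int (2 * \<nu>) * s - 4 * r \<in> zspan {s, r, z, w}"
        by (intro zspan_intros zmod.span_base) auto
      then show "{s, q, r, w} \<subseteq> zspan ((\<lambda>(e, f, d). e) ` set ?xs)"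
        by (simp add: zmod.span_base z_def)
      have "3 * v - u \<in> zspan {F1, u, v, s}" "of_int n * v - of_int \<nu> * u \<in> zspan {F1, u, v, s}"
        by (intro zspan_intros zmod.span_base; simp)+
      moreover have "3 * v - u = F2" "of_int n * v - of_int \<nu> * u = F3"
        unfolding u_def v_def by (simp_all only: pointwise) (simp_all add: 2 algebra_simps)
      ultimately show "{s, q, r, w} \<subseteq> zspan ((\<lambda>(e, f, d). f) ` set ?xs)"
        using F_span[of "{F1, u, v, s}"] by (simp add: zmod.span_base)
    qed simp
    then show ?thesis using 2 by (simp add: add_mset_commute)
  next
    case (3 \<nu>)
    define u v y z x where "u = 4 * F2 + F1" and "v = 3 * F3 - of_int n * F2"
      and "y = of_int (2 * \<nu> + 1) * F2 - 2 * F3"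
      and "z = q + of_int (2 * \<nu> + 1) * s" and "x = s - 3 * z - 24 * r"
    let ?xs = "[(z, u, 1), (r, v, 1), (x, y, 36), (w, s, 0)]"
    have "has_diagonal L {s, q, r, w} {#1, 1, 36, 0#}"
    proof (rule has_diagonalI)
      have "L z = of_int 1 * u"
        unfolding z_def u_def L_simps by (simp only: pointwise) (simp add: 3 algebra_simps)
      moreover have "L r = of_int 1 * v"
        unfolding v_def L_simps by (simp only: pointwise) (simp add: algebra_simps)
      moreover have "L x = of_int 36 * y"
        unfolding x_def z_def y_def L_simps by (simp only: pointwise) (simp add: 3 algebra_simps)
      ultimately show "L e = of_int d * f" if "(e, f, d) \<in> set ?xs" for e f d
        using that w by auto
      have "x + 3 * z + 24 * r \<in> zspan {z, r, x, w}"
        by (intro zspan_intros zmod.span_base) auto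
      then have sE: "s \<in> zspan {z, r, x, w}" by (simp add: x_def)
      then have "z - of_int (2 * \<nu> + 1) * s \<in> zspan {z, r, x, w}"
        by (intro zspan_intros) (auto intro: zmod.span_base)
      then show "{s, q, r, w} \<subseteq> zspan ((\<lambda>(e, f, d). e) ` set ?xs)"
        using sE by (simp add: zmod.span_base z_def)
      have "- (2 * v) - 3 * y \<in> zspan {u, v, y, s}"
        "- (of_int (2 * \<nu> + 1) * v) - of_int n * y \<in> zspan {u, v, y, s}"
        by (intro zspan_intros zmod.span_base; simp)+
      moreover have "- (2 * v) - 3 * y = F2" "- (of_int (2 * \<nu> + 1) * v) - of_int n * y = F3"
        unfolding v_def y_def by (simp_all only: pointwise) (simp_all add: 3 algebra_simps)
      ultimately have F: "F2 \<in> zspan {u, v, y, s}" "F3 \<in> zspan {u, v, y, s}" by simp_all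
      then have "u - 4 * F2 \<in> zspan {u, v, y, s}"
        by (intro zspan_intros) (auto intro: zmod.span_base)
      then show "{s, q, r, w} \<subseteq> zspan ((\<lambda>(e, f, d). f) ` set ?xs)"
        using F_span[of "{u, v, y, s}"] F by (simp add: u_def zmod.span_base)
    qed simp
    then show ?thesis using 3 by (simp add: add_mset_commute)
  qed
qed

section \<open>The Laplacian on functions of triples\<close>

locale johnson =
  fixes n :: nat
  assumes n_ge_7: "7 \<le> n"
begin

abbreviation V :: "nat set set" where "V \<equiv> Gamma_verts n 3"

definition x :: "nat set \<Rightarrow> nat set \<Rightarrow> int" where
  "x S = (\<lambda>T. of_bool (T \<in> V \<and> S \<subseteq> T))"

definition Lap :: "(nat set \<Rightarrow> int) \<Rightarrow> nat set \<Rightarrow> int" where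
  "Lap f = (\<lambda>T. of_bool (T \<in> V) * ((\<Sum>U | Gamma_adj n 3 2 T U. f U) - 3 * (int n - 3) * f T))"

lemma vertexD: "T \<in> V \<Longrightarrow> T \<subseteq> {1..n}" "T \<in> V \<Longrightarrow> card T = 3" "T \<in> V \<Longrightarrow> finite T"
  by (auto simp: Gamma_verts_def intro: card_ge_0_finite)

lemma finite_V: "finite V"
  by (rule finite_subset[of _ "Pow {1..n}"]) (auto simp: Gamma_verts_def)

lemma additive_Lap: "additive Lap"
  by standard (simp add: Lap_def fun_eq_iff sum.distrib algebra_simps)

text \<open>A neighbour of \<open>T\<close> arises by exchanging a point \<open>i\<close> of \<open>T\<close> for a point \<open>j\<close> outside.\<close>

lemma sum_neighbours:
  assumes T: "T \<in> V"
  shows "(\<Sum>U | Gamma_adj n 3 2 T U. f U) = (\<Sum>i\<in>T. \<Sum>j\<in>{1..n} - T. f (insert j (T - {i})))"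
proof -
  note T' = vertexD[OF T]
  have "bij_betw (\<lambda>(i, j). insert j (T - {i})) (T \<times> ({1..n} - T)) {U. Gamma_adj n 3 2 T U}"
  proof (rule bij_betwI[where g = "\<lambda>U. (the_elem (T - U), the_elem (U - T))"])
    show "(\<lambda>(i, j). insert j (T - {i})) \<in> T \<times> ({1..n} - T) \<rightarrow> {U. Gamma_adj n 3 2 T U}"
    proof clarsimp
      fix i j assume ij: "i \<in> T" "Suc 0 \<le> j" "j \<le> n" "j \<notin> T"
      have "T \<inter> insert j (T - {i}) = T - {i}" using ij by auto
      then show "Gamma_adj n 3 2 T (insert j (T - {i}))"
        using T T' ij unfolding Gamma_adj_def Gamma_verts_def
        by (auto simp: card_insert_if)
    qed
  next
    fix ij assume "ij \<in> T \<times> ({1..n} - T)"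
    then obtain i j where ij: "ij = (i, j)" "i \<in> T" "j \<notin> T" by auto
    then have "T - insert j (T - {i}) = {i}" "insert j (T - {i}) - T = {j}" by auto
    then show "(\<lambda>U. (the_elem (T - U), the_elem (U - T))) ((\<lambda>(i, j). insert j (T - {i})) ij) = ij"
      using ij by simp
  next
    have *: "\<exists>i\<in>T. \<exists>j\<in>{1..n} - T. T - U = {i} \<and> U - T = {j} \<and> U = insert j (T - {i})"
      if "Gamma_adj n 3 2 T U" for U
    proof -
      have U: "U \<in> V" "card (T \<inter> U) = 2" using that by (auto simp: Gamma_adj_def)
      note U' = vertexD[OF U(1)]
      have "card (T - U) = 1" "card (U - T) = 1"
        using U(2) T' U' by (simp_all add: card_Diff_subset_Int Int_commute)
      then obtain i j where "T - U = {i}" "U - T = {j}" by (auto simp: card_1_singleton_iff)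
      then show ?thesis using U' by blast
    qed
    show "(\<lambda>U. (the_elem (T - U), the_elem (U - T))) \<in> {U. Gamma_adj n 3 2 T U} \<rightarrow> T \<times> ({1..n} - T)"
      using * by fastforce
    fix U assume "U \<in> {U. Gamma_adj n 3 2 T U}"
    then show "(\<lambda>(i, j). insert j (T - {i})) (the_elem (T - U), the_elem (U - T)) = U"
      using * by fastforce
  qed
  from sum.reindex_bij_betw[OF this, of f] show ?thesis
    by (simp add: sum.cartesian_product case_prod_unfold)
qed

text \<open>Evaluate at a triple \<open>T\<close>. If \<open>S \<subseteq> T\<close>, the exchanges that keep \<open>S\<close> remove a point of \<open>T - S\<close>; if one point
of \<open>S\<close> is missing from \<open>T\<close>, the exchange must bring it in and remove one of the \<open>4 - k\<close> points of
\<open>T - S\<close>, where \<open>k = card S\<close>; otherwise both sides vanish.\<close>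

lemma Lap_x:
  assumes S: "S \<subseteq> {1..n}"
  shows "Lap (x S) = of_int (4 - int (card S)) * (\<Sum>a\<in>S. x (S - {a}))
    - of_int (int (card S) * (int n + 1 - int (card S))) * x S"
proof (rule ext)
  fix T
  have finS: "finite S" using S finite_subset by blast
  show "Lap (x S) T = (of_int (4 - int (card S)) * (\<Sum>a\<in>S. x (S - {a}))
    - of_int (int (card S) * (int n + 1 - int (card S))) * x S) T"
  proof (cases "T \<in> V")
    case False
    then show ?thesis by (simp add: Lap_def x_def sum_fun_apply)
  next
    case T: True
    note T' = vertexD[OF T]
    have V: "insert j (T - {i}) \<in> V" if "i \<in> T" "j \<in> {1..n} - T" for i j
      using that T' by (auto simp: Gamma_verts_def)
    have nb: "(\<Sum>U | Gamma_adj n 3 2 T U. x S U)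
        = (\<Sum>i\<in>T. \<Sum>j\<in>{1..n} - T. of_bool (S \<subseteq> insert j (T - {i})))"
      unfolding sum_neighbours[OF T] by (intro sum.cong refl) (simp add: x_def V)
    have card_compl: "int (card ({1..n} - T)) = int n - 3"
      using T' n_ge_7 by (simp add: card_Diff_subset)
    consider "S \<subseteq> T" | j0 where "S - T = {j0}" | j1 j2 where "j1 \<in> S - T" "j2 \<in> S - T" "j1 \<noteq> j2"
      by blast
    then show ?thesis
    proof cases
      case 1
      then have "(S \<subseteq> insert j (T - {i})) = (i \<notin> S)" if "j \<in> {1..n} - T" for i j
        using that by auto
      then have "(\<Sum>U | Gamma_adj n 3 2 T U. x S U) = (\<Sum>i\<in>T. \<Sum>j\<in>{1..n} - T. of_bool (i \<notin> S))"
        unfolding nb by (intro sum.cong refl) simp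
      also have "\<dots> = (int n - 3) * int (card (T - S))"
      proof -
        have "T \<inter> {i. i \<notin> S} = T - S" by auto
        then show ?thesis
          using card_compl T' by (simp add: sum_distrib_left[symmetric])
      qed
      also have "card (T - S) = 3 - card S"
        using 1 T' finS by (simp add: card_Diff_subset)
      also have "int (3 - card S) = 3 - int (card S)"
        using 1 T' by (metis card_mono of_nat_diff of_nat_numeral)
      finally have "(\<Sum>U | Gamma_adj n 3 2 T U. x S U) = (int n - 3) * (3 - int (card S))" .
      moreover have "x (S - {a}) T = 1" for a using 1 T by (auto simp: x_def)
      moreover have "x S T = 1" using 1 T by (simp add: x_def)
      ultimately show ?thesis
        using T by (simp add: Lap_def sum_fun_apply algebra_simps)
    next
      case (2 j0)
      then have "(S \<subseteq> insert j (T - {i})) = (i \<notin> S \<and> j = j0)" if "i \<in> T" "j \<in> {1..n} - T" for i j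
        using that by blast
      then have "(\<Sum>U | Gamma_adj n 3 2 T U. x S U)
          = (\<Sum>i\<in>T. \<Sum>j\<in>{1..n} - T. of_bool (i \<notin> S) * of_bool (j = j0))"
        unfolding nb by (intro sum.cong refl) simp
      also have "\<dots> = int (card (T - S))"
      proof -
        have "T \<inter> {i. i \<notin> S} = T - S" "({1..n} - T) \<inter> {j. j = j0} = {j0}"
          using 2 S by auto
        then show ?thesis
          using T' by (simp add: sum_distrib_left[symmetric])
      qed
      also have "int (card (T - S)) = 4 - int (card S)"
      proof -
        have "card S = card (S \<inter> T) + card (S - T)" "card T = card (S \<inter> T) + card (T - S)"
          using finS T' card_Int_Diff[of S T] card_Int_Diff[of T S] by (auto simp: Int_commute)
        then show ?thesis using 2 T' by simp
      qed
      finally have "(\<Sum>U | Gamma_adj n 3 2 T U. x S U) = 4 - int (card S)" .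
      moreover have "(\<Sum>a\<in>S. x (S - {a}) T) = 1"
      proof -
        have "x (S - {a}) T = of_bool (a = j0)" if "a \<in> S" for a
          using 2 T that by (auto simp: x_def)
        moreover have "j0 \<in> S" using 2 by auto
        ultimately show ?thesis using finS by (simp add: of_bool_def)
      qed
      moreover have "x S T = 0" using 2 by (auto simp: x_def)
      ultimately show ?thesis
        using T by (simp add: Lap_def sum_fun_apply)
    next
      case (3 j1 j2)
      then have "\<not> S \<subseteq> insert j (T - {i})" for i j by auto
      then have "(\<Sum>U | Gamma_adj n 3 2 T U. x S U) = 0"
        unfolding nb by simp
      moreover have "x (S - {a}) T = 0" for a using 3 by (auto simp: x_def)
      moreover have "x S T = 0" using 3 by (auto simp: x_def)
      ultimately show ?thesis
        by (simp add: Lap_def sum_fun_apply)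
    qed
  qed
qed

text \<open>A triple containing \<open>S\<close> has \<open>3 - card S\<close> further points.\<close>

lemma star_relation:
  assumes "finite S"
  shows "(\<Sum>a\<in>{1..n} - S. x (insert a S)) = of_int (3 - int (card S)) * x S"
proof (rule ext)
  fix T
  show "(\<Sum>a\<in>{1..n} - S. x (insert a S)) T = (of_int (3 - int (card S)) * x S) T"
  proof (cases "T \<in> V \<and> S \<subseteq> T")
    case True
    then have T: "T \<subseteq> {1..n}" "card T = 3" "finite T" "S \<subseteq> T" "T \<in> V" using vertexD by auto
    have "(\<Sum>a\<in>{1..n} - S. x (insert a S) T) = (\<Sum>a\<in>{1..n} - S. of_bool (a \<in> T))"
      using T by (simp add: x_def)
    also have "\<dots> = int (card (({1..n} - S) \<inter> T))"
      by (simp add: of_bool_def sum.If_cases Int_def)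
    also have "({1..n} - S) \<inter> T = T - S" using T by auto
    also have "int (card (T - S)) = 3 - int (card S)"
      using T assms card_mono[of T S] by (simp add: card_Diff_subset of_nat_diff)
    finally show ?thesis using T by (simp add: sum_fun_apply x_def)
  next
    case False
    then show ?thesis by (auto simp: sum_fun_apply x_def)
  qed
qed

lemma x_vertex:
  assumes "T \<in> V" shows "x T = (\<lambda>U. of_bool (U = T))"
proof -
  have "U \<in> V \<and> T \<subseteq> U \<longleftrightarrow> U = T" for U
    using assms card_subset_eq[of U T] vertexD[of U] vertexD[of T] by auto
  then show ?thesis by (simp add: x_def)
qed

text \<open>Both sides are the indicator function of the triples that contain \<open>R\<close> but not \<open>n\<close>.\<close>

lemma avoid_top_relation:
  "(\<Sum>T | T \<in> V \<and> n \<notin> T \<and> R \<subseteq> T. x T) = x R - x (insert n R)"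
proof (rule ext)
  fix U
  have "(\<Sum>T | T \<in> V \<and> n \<notin> T \<and> R \<subseteq> T. x T) U
      = (\<Sum>T | T \<in> V \<and> n \<notin> T \<and> R \<subseteq> T. if U = T then 1 else 0)"
    unfolding sum_fun_apply by (intro sum.cong refl) (simp add: x_vertex)
  also have "\<dots> = (x R - x (insert n R)) U"
    using finite_V by (subst sum.delta') (auto simp: x_def)
  finally show "(\<Sum>T | T \<in> V \<and> n \<notin> T \<and> R \<subseteq> T. x T) U = (x R - x (insert n R)) U" .
qed

text \<open>A triple avoiding \<open>n\<close> contains three of the pairs, a triple through \<open>n\<close> only one.\<close>

lemma avoid_top_pair_relation:
  "(\<Sum>S | S \<subseteq> {1..n - 1} \<and> card S = 2. x S) = 3 * x {} - 2 * x {n}"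
proof (rule ext)
  fix T
  show "(\<Sum>S | S \<subseteq> {1..n - 1} \<and> card S = 2. x S) T = (3 * x {} - 2 * x {n}) T"
  proof (cases "T \<in> V")
    case True
    note T = vertexD[OF True]
    have "(\<Sum>S | S \<subseteq> {1..n - 1} \<and> card S = 2. x S) T
        = int (card ({S. S \<subseteq> {1..n - 1} \<and> card S = 2} \<inter> {S. S \<subseteq> T}))"
      using True by (simp add: sum_fun_apply x_def of_bool_def sum.If_cases)
    also have "{S. S \<subseteq> {1..n - 1} \<and> card S = 2} \<inter> {S. S \<subseteq> T} = {S. S \<subseteq> T - {n} \<and> card S = 2}"
      using T by (fastforce simp: subset_iff)
    also have "card \<dots> = card (T - {n}) choose 2"
      using T by (intro n_subsets) auto
    also have "int \<dots> = (3 * x {} - 2 * x {n}) T"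
      using True T by (auto simp: x_def numeral_eq_Suc)
    finally show ?thesis .
  next
    case False
    then show ?thesis by (simp add: sum_fun_apply x_def)
  qed
qed

section \<open>A decomposition into invariant chains\<close>

text \<open>The points 1 to 6 have special roles below, the top point \<open>n\<close> is eliminated by linear relations, and
3 is the base point of all chains.\<close>

definition A :: "nat set" where "A = {1..n - 1} - {3}"

lemma finite_A [simp]: "finite A" by (simp add: A_def)

lemma in_A [simp]: "1 \<in> A" "2 \<in> A" "4 \<in> A" "5 \<in> A" "6 \<in> A" "3 \<notin> A" "n \<notin> A" "Suc 0 \<in> A"
  using n_ge_7 by (auto simp: A_def)

lemma AD: "a \<in> A \<Longrightarrow> a \<in> {1..n}" "a \<in> A \<Longrightarrow> a \<noteq> 3" "a \<in> A \<Longrightarrow> a \<noteq> n"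
  using n_ge_7 by (auto simp: A_def)

lemma three_le: "3 \<in> {1..n}"
  using n_ge_7 by auto

lemma Lap_empty: "Lap (x {}) = 0"
  using Lap_x[of "{}"] by simp

lemma Lap_x1: "a \<in> {1..n} \<Longrightarrow> Lap (x {a}) = 3 * x {} - of_int (int n) * x {a}"
  using Lap_x[of "{a}"] by simp

lemma Lap_x2:
  assumes "a \<in> {1..n}" "b \<in> {1..n}" "a \<noteq> b"
  shows "Lap (x {a, b}) = 2 * (x {a} + x {b}) - of_int (2 * (int n - 1)) * x {a, b}"
proof -
  have "{a, b} - {a} = {b}" "{a, b} - {b} = {a}" using assms by auto
  then show ?thesis using Lap_x[of "{a, b}"] assms by (simp add: algebra_simps)
qed

lemma Lap_x3:
  assumes "a \<in> {1..n}" "b \<in> {1..n}" "c \<in> {1..n}" "a \<noteq> b" "a \<noteq> c" "b \<noteq> c"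
  shows "Lap (x {a, b, c}) = x {a, b} + x {a, c} + x {b, c} - of_int (3 * (int n - 2)) * x {a, b, c}"
proof -
  have "{a, b, c} - {a} = {b, c}" "{a, b, c} - {b} = {a, c}" "{a, b, c} - {c} = {a, b}"
    using assms by auto
  then show ?thesis using Lap_x[of "{a, b, c}"] assms by (simp add: algebra_simps)
qed

text \<open>The elements \<open>x {3}\<close>, \<open>r a\<close>; \<open>e\<^sub>2\<close>, \<open>q a\<close>, \<open>p S\<close> have vertex degrees arranged so that lowering them
gives \<open>4 x {3}\<close>, \<open>2 r a\<close> and \<open>0\<close>. In the graph of all pairs on \<open>{1..n - 1}\<close> the star at 3 together with
the edge \<open>{4, 5}\<close> is a connected spanning subgraph with one odd cycle; \<open>p S\<close> is the unique way to
complete the edge \<open>S\<close> by this subgraph to a combination with all degrees zero.\<close>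

definition e\<^sub>2 :: "nat set \<Rightarrow> int" where "e\<^sub>2 = x {3, 4} + x {3, 5} - x {4, 5}"

definition r :: "nat \<Rightarrow> nat set \<Rightarrow> int" where "r a = x {a} - x {3}"

definition q :: "nat \<Rightarrow> nat set \<Rightarrow> int" where "q a = x {3, a} - e\<^sub>2"

definition p :: "nat set \<Rightarrow> nat set \<Rightarrow> int" where "p S = x S - (\<Sum>a\<in>S. x {3, a}) + e\<^sub>2"

text \<open>The signs are chosen so that the boundary \<open>-2 (x {3, a} + x {3, b} + x {3, c})\<close> only involves pairs through
the base point.\<close>

definition y :: "nat \<Rightarrow> nat \<Rightarrow> nat \<Rightarrow> nat set \<Rightarrow> int" where
  "y a b c = x {a, b, c} - x {3, a, b} - x {3, a, c} - x {3, b, c}"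

definition d :: "nat \<Rightarrow> nat set \<Rightarrow> int" where "d v = y 4 5 v + x {3, 4, 5}"

text \<open>The combinations \<open>t\<^sub>4\<close>, \<open>t\<^sub>5\<close> are chosen so that in their boundaries everything but \<open>2 q 4\<close> and
\<open>2 q 5\<close> cancels. Since \<open>{3, 4, 5}\<close> has boundary \<open>2 q 4 + 2 q 5 + 3 e\<^sub>2\<close>, this isolates \<open>3 e\<^sub>2\<close>, and then
the boundary \<open>- 2 q v - 3 e\<^sub>2\<close> of \<open>d v\<close> yields the remaining \<open>2 q v\<close>.\<close>

definition t\<^sub>4 :: "nat set \<Rightarrow> int" where "t\<^sub>4 = d 2 + d 6 - y 2 4 6"

definition t\<^sub>5 :: "nat set \<Rightarrow> int" where "t\<^sub>5 = d 1 + d 6 - y 1 5 6"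

definition e\<^sub>3 :: "nat set \<Rightarrow> int" where "e\<^sub>3 = x {3, 4, 5} - t\<^sub>4 - t\<^sub>5"

definition t :: "nat \<Rightarrow> nat set \<Rightarrow> int" where
  "t a = (if a = 4 then t\<^sub>4 else if a = 5 then t\<^sub>5 else - d a - e\<^sub>3)"

definition g :: "nat set \<Rightarrow> nat set \<Rightarrow> int" where "g S = x (insert 3 S) - (\<Sum>a\<in>S. t a) - e\<^sub>3"

definition h :: "nat set \<Rightarrow> nat set \<Rightarrow> int" where
  "h T = x T - (\<Sum>a\<in>T. g (T - {a})) - (\<Sum>a\<in>T. t a) - e\<^sub>3"

lemmas Lap_add = additive.add[OF additive_Lap] and Lap_diff = additive.diff[OF additive_Lap]
  and Lap_minus = additive.minus[OF additive_Lap]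

text \<open>On triples this is the boundary, the sum of the three pairs; on \<open>h T\<close> it vanishes.\<close>

definition bdry :: "(nat set \<Rightarrow> int) \<Rightarrow> nat set \<Rightarrow> int" where
  "bdry f = Lap f + of_int (3 * (int n - 2)) * f"

lemma Lap_bdry: "Lap f = bdry f - of_int (3 * (int n - 2)) * f"
  by (simp add: bdry_def)

lemma bdry_add: "bdry (f + f') = bdry f + bdry f'" and bdry_diff: "bdry (f - f') = bdry f - bdry f'"
  and bdry_minus: "bdry (- f) = - bdry f"
  unfolding bdry_def Lap_add Lap_diff Lap_minus
  by (simp_all only: pointwise) (simp_all add: algebra_simps)

lemma bdry_x3:
  assumes "a \<in> {1..n}" "b \<in> {1..n}" "c \<in> {1..n}" "a \<noteq> b" "a \<noteq> c" "b \<noteq> c"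
  shows "bdry (x {a, b, c}) = x {a, b} + x {a, c} + x {b, c}"
  by (simp add: bdry_def Lap_x3[OF assms])

lemma x3_eq: "x {3, a} = q a + e\<^sub>2"
  by (simp add: q_def)

lemma Lap_e1: "Lap (x {3}) = 3 * x {} - of_int (int n) * x {3}"
  by (rule Lap_x1[OF three_le])

lemma Lap_r: "a \<in> A \<Longrightarrow> Lap (r a) = - (of_int (int n) * r a)"
  unfolding r_def Lap_diff Lap_e1 using Lap_x1[OF AD(1)[of a]]
  by (simp only: pointwise) (simp add: algebra_simps)

lemma Lap_e2: "Lap e\<^sub>2 = 4 * x {3} - of_int (2 * (int n - 1)) * e\<^sub>2"
proof -
  have *: "Lap (x {3, 4}) = 2 * (x {3} + x {4}) - of_int (2 * (int n - 1)) * x {3, 4}"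
    "Lap (x {3, 5}) = 2 * (x {3} + x {5}) - of_int (2 * (int n - 1)) * x {3, 5}"
    "Lap (x {4, 5}) = 2 * (x {4} + x {5}) - of_int (2 * (int n - 1)) * x {4, 5}"
    by (rule Lap_x2; use n_ge_7 in simp)+
  show ?thesis
    unfolding e\<^sub>2_def Lap_add Lap_diff *
    by (simp only: pointwise) (simp add: algebra_simps)
qed

lemma Lap_q:
  assumes "a \<in> A"
  shows "Lap (q a) = 2 * r a - of_int (2 * (int n - 1)) * q a"
  unfolding q_def r_def Lap_diff Lap_e2 Lap_x2[OF three_le AD(1)[OF assms] AD(2)[OF assms, symmetric]]
  by (simp only: pointwise) (simp add: algebra_simps)

lemma p_doubleton: "a \<noteq> b \<Longrightarrow> p {a, b} = x {a, b} - x {3, a} - x {3, b} + e\<^sub>2"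
  by (simp add: p_def algebra_simps)

lemma Lap_p:
  assumes "S \<subseteq> A" "card S = 2"
  shows "Lap (p S) = - (of_int (2 * (int n - 1)) * p S)"
proof -
  obtain a b where S: "S = {a, b}" "a \<noteq> b" using assms(2) by (auto simp: card_2_iff)
  have ab: "a \<in> A" "b \<in> A" using S assms by auto
  note A = AD[OF ab(1)] AD[OF ab(2)]
  show ?thesis
    unfolding S(1) p_doubleton[OF S(2)] Lap_diff Lap_add Lap_e2 Lap_x2[OF A(1) A(4) S(2)]
      Lap_x2[OF three_le A(1) A(2)[symmetric]] Lap_x2[OF three_le A(4) A(5)[symmetric]]
    by (simp only: pointwise) (simp add: algebra_simps)
qed

lemma bdry_x345: "bdry (x {3, 4, 5}) = 2 * q 4 + 2 * q 5 + 3 * e\<^sub>2"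
proof -
  have *: "x {4, 5} = x {3, 4} + x {3, 5} - e\<^sub>2" by (simp add: e\<^sub>2_def)
  have "bdry (x {3, 4, 5}) = x {3, 4} + x {3, 5} + x {4, 5}"
    by (rule bdry_x3) (use n_ge_7 in auto)
  then show ?thesis
    unfolding * x3_eq by (simp only: pointwise) (simp add: algebra_simps)
qed

lemma bdry_y:
  assumes "a \<in> A" "b \<in> A" "c \<in> A" "a \<noteq> b" "a \<noteq> c" "b \<noteq> c"
  shows "bdry (y a b c) = - (2 * (q a + q b + q c)) - 6 * e\<^sub>2"
proof -
  note A = AD(1,2)[OF assms(1)] AD(1,2)[OF assms(2)] AD(1,2)[OF assms(3)]
  show ?thesis
    unfolding y_def bdry_diff bdry_x3[OF A(1,3,5) assms(4-6)]
      bdry_x3[OF three_le A(1) A(3) A(2)[symmetric] A(4)[symmetric] assms(4)]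
      bdry_x3[OF three_le A(1) A(5) A(2)[symmetric] A(6)[symmetric] assms(5)]
      bdry_x3[OF three_le A(3) A(5) A(4)[symmetric] A(6)[symmetric] assms(6)] x3_eq
    by (simp only: pointwise) (simp add: algebra_simps)
qed

lemma bdry_d:
  assumes "v \<in> A" "v \<noteq> 4" "v \<noteq> 5"
  shows "bdry (d v) = - (2 * q v) - 3 * e\<^sub>2"
proof -
  have *: "bdry (y 4 5 v) = - (2 * (q 4 + q 5 + q v)) - 6 * e\<^sub>2"
    by (rule bdry_y) (use assms in auto)
  show ?thesis
    unfolding d_def bdry_add * bdry_x345 by (simp only: pointwise) (simp add: algebra_simps)
qed

lemma bdry_t4: "bdry t\<^sub>4 = 2 * q 4"
proof -
  have *: "bdry (d 2) = - (2 * q 2) - 3 * e\<^sub>2" "bdry (d 6) = - (2 * q 6) - 3 * e\<^sub>2"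
    by (rule bdry_d; simp)+
  have **: "bdry (y 2 4 6) = - (2 * (q 2 + q 4 + q 6)) - 6 * e\<^sub>2" by (rule bdry_y) simp_all
  show ?thesis
    unfolding t\<^sub>4_def bdry_diff bdry_add * ** by (simp only: pointwise) (simp add: algebra_simps)
qed

lemma bdry_t5: "bdry t\<^sub>5 = 2 * q 5"
proof -
  have *: "bdry (d 1) = - (2 * q 1) - 3 * e\<^sub>2" "bdry (d 6) = - (2 * q 6) - 3 * e\<^sub>2"
    by (rule bdry_d; simp)+
  have **: "bdry (y 1 5 6) = - (2 * (q 1 + q 5 + q 6)) - 6 * e\<^sub>2" by (rule bdry_y) simp_all
  show ?thesis
    unfolding t\<^sub>5_def bdry_diff bdry_add * ** by (simp only: pointwise) (simp add: algebra_simps)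
qed

lemma bdry_e3: "bdry e\<^sub>3 = 3 * e\<^sub>2"
  unfolding e\<^sub>3_def bdry_diff bdry_x345 bdry_t4 bdry_t5
  by (simp only: pointwise) (simp add: algebra_simps)

lemma bdry_t:
  assumes "a \<in> A"
  shows "bdry (t a) = 2 * q a"
proof (cases "a = 4 \<or> a = 5")
  case True
  then show ?thesis by (auto simp: t_def bdry_t4 bdry_t5)
next
  case False
  then have *: "bdry (d a) = - (2 * q a) - 3 * e\<^sub>2" by (intro bdry_d assms) auto
  have "t a = - d a - e\<^sub>3" using False by (simp add: t_def)
  then show ?thesis
    unfolding \<open>t a = - d a - e\<^sub>3\<close> bdry_diff bdry_minus * bdry_e3
    by (simp only: pointwise) (simp add: algebra_simps)
qed

lemma g_doubleton: "a \<noteq> b \<Longrightarrow> g {a, b} = x {3, a, b} - t a - t b - e\<^sub>3"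
  by (simp add: g_def algebra_simps)

lemma bdry_g:
  assumes "S \<subseteq> A" "card S = 2"
  shows "bdry (g S) = p S"
proof -
  obtain a b where S: "S = {a, b}" "a \<noteq> b" using assms(2) by (auto simp: card_2_iff)
  have ab: "a \<in> A" "b \<in> A" using S assms by auto
  note A = AD[OF ab(1)] AD[OF ab(2)]
  show ?thesis
    unfolding S(1) p_doubleton[OF S(2)] g_doubleton[OF S(2)] bdry_diff bdry_t[OF ab(1)] bdry_t[OF ab(2)]
      bdry_e3 bdry_x3[OF three_le A(1,4) A(2)[symmetric] A(5)[symmetric] S(2)] x3_eq
    by (simp only: pointwise) (simp add: algebra_simps)
qed

lemma bdry_h:
  assumes "T \<subseteq> A" "card T = 3"
  shows "bdry (h T) = 0"
proof -
  obtain a b c where T: "T = {a, b, c}" and ne: "a \<noteq> b" "a \<noteq> c" "b \<noteq> c"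
    using assms(2) by (auto simp: card_3_iff)
  have abc: "a \<in> A" "b \<in> A" "c \<in> A" using T assms by auto
  note A = AD(1,2)[OF abc(1)] AD(1,2)[OF abc(2)] AD(1,2)[OF abc(3)]
  have "{a, b, c} - {a} = {b, c}" "{a, b, c} - {b} = {a, c}" "{a, b, c} - {c} = {a, b}"
    using ne by auto
  then have h: "h T = x {a, b, c} - (g {b, c} + g {a, c} + g {a, b}) - (t a + t b + t c) - e\<^sub>3"
    unfolding h_def T using ne by (simp add: algebra_simps)
  have bdry_gs: "bdry (g {b, c}) = p {b, c}" "bdry (g {a, c}) = p {a, c}" "bdry (g {a, b}) = p {a, b}"
    by (rule bdry_g; use abc ne in auto)+
  show ?thesis
    unfolding h bdry_diff bdry_add bdry_gs bdry_t[OF abc(1)] bdry_t[OF abc(2)] bdry_t[OF abc(3)] bdry_e3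
      bdry_x3[OF A(1,3,5) ne] p_doubleton[OF ne(1)] p_doubleton[OF ne(2)] p_doubleton[OF ne(3)] x3_eq
    by (simp only: pointwise) (simp add: algebra_simps)
qed

lemma Lap_e3: "Lap e\<^sub>3 = 3 * e\<^sub>2 - of_int (3 * (int n - 2)) * e\<^sub>3"
  by (simp only: Lap_bdry bdry_e3)

lemma Lap_t: "a \<in> A \<Longrightarrow> Lap (t a) = 2 * q a - of_int (3 * (int n - 2)) * t a"
  by (simp only: Lap_bdry bdry_t)

lemma Lap_g: "S \<subseteq> A \<Longrightarrow> card S = 2 \<Longrightarrow> Lap (g S) = p S - of_int (3 * (int n - 2)) * g S"
  by (simp only: Lap_bdry bdry_g)

lemma Lap_h: "T \<subseteq> A \<Longrightarrow> card T = 3 \<Longrightarrow> Lap (h T) = - (of_int (3 * (int n - 2)) * h T)"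
  by (simp only: Lap_bdry bdry_h diff_0)

section \<open>The chains span\<close>

text \<open>The pair \<open>{4, 5}\<close> is left out because \<open>p {4, 5} = 0\<close>, and \<open>{1, 2}\<close> because \<open>x {1, 2}\<close> is determined by
the other pairs and smaller sets.\<close>

definition Prs :: "nat set set" where
  "Prs = {S. S \<subseteq> A \<and> card S = 2} - {{1, 2}, {4, 5}}"

text \<open>The triples \<open>{4, 5, v}\<close>, \<open>{1, 5, 6}\<close>, \<open>{2, 4, 6}\<close> are used up in \<open>e\<^sub>3\<close> and the \<open>t a\<close>, while \<open>{1, 2, v}\<close>,
\<open>{1, 4, 6}\<close>, \<open>{2, 5, 6}\<close> are determined by the other triples and smaller sets.\<close>

definition Trp :: "nat set set" where
  "Trp = {T. T \<subseteq> A \<and> card T = 3 \<and> \<not> {1, 2} \<subseteq> T \<and> \<not> {4, 5} \<subseteq> T}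
     - {{1, 4, 6}, {1, 5, 6}, {2, 4, 6}, {2, 5, 6}}"

definition G :: "(nat set \<Rightarrow> int) set" where
  "G = {e\<^sub>3, e\<^sub>2, x {3}, x {}} \<union> (\<Union>a\<in>A. {t a, q a, r a}) \<union> (\<Union>S\<in>Prs. {g S, p S}) \<union> (\<Union>T\<in>Trp. {h T})"

lemma span_x1: "a \<in> {1..n} \<Longrightarrow> x {a} \<in> zspan G"
proof -
  have w: "x {} \<in> zspan G" and e1: "x {3} \<in> zspan G"
    by (auto simp: G_def intro!: zmod.span_base)
  have low: "x {a} \<in> zspan G" if "a \<in> {1..n} - {n}" for a
  proof (cases "a = 3")
    case False
    then have "a \<in> A" using that by (auto simp: A_def)
    then have "r a + x {3} \<in> zspan G"
      by (intro zmod.span_add e1 zmod.span_base) (auto simp: G_def)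
    then show ?thesis by (simp add: r_def)
  qed (use e1 in simp)
  have "(\<Sum>a\<in>{1..n}. x {a}) = x {n} + (\<Sum>a\<in>{1..n} - {n}. x {a})"
    using n_ge_7 by (intro sum.remove) auto
  moreover have "(\<Sum>a\<in>{1..n}. x {a}) = 3 * x {}"
    using star_relation[of "{}"] by simp
  ultimately have "x {n} = 3 * x {} - (\<Sum>a\<in>{1..n} - {n}. x {a})"
    by (simp add: algebra_simps)
  moreover have "3 * x {} - (\<Sum>a\<in>{1..n} - {n}. x {a}) \<in> zspan G"
    by (intro zspan_intros zmod.span_sum w low)
  ultimately have "x {n} \<in> zspan G" by simp
  then show "a \<in> {1..n} \<Longrightarrow> x {a} \<in> zspan G" using low[of a] by (cases "a = n") auto
qed

lemma low_pair_cases: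
  assumes "S \<subseteq> {1..n - 1}" "card S = 2"
  obtains a where "a \<in> A" "S = {3, a}" | "S \<in> Prs" | "S = {4, 5}" | "S = {1, 2}"
proof (cases "3 \<in> S")
  case True
  then obtain a where "S = {3, a}" "a \<noteq> 3" using assms(2) by (auto simp: card_2_iff)
  moreover have "a \<in> A" using calculation assms(1) by (auto simp: A_def)
  ultimately show ?thesis using that(1) by blast
next
  case False
  then have "S \<subseteq> A" using assms(1) by (auto simp: A_def)
  then show ?thesis using that(2-4) assms(2) by (auto simp: Prs_def)
qed

lemma span_x3a: "a \<in> A \<Longrightarrow> x {3, a} \<in> zspan G"
  unfolding x3_eq by (intro zmod.span_add zmod.span_base) (auto simp: G_def)

lemma span_e2: "e\<^sub>2 \<in> zspan G"
  by (intro zmod.span_base) (simp add: G_def)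

text \<open>All pairs below \<open>n\<close> but \<open>{1, 2}\<close> are reached by the chains; this last one has coefficient 1 in the
relation for the sum of all of them.\<close>

lemma span_low_pair:
  assumes "S \<subseteq> {1..n - 1}" "card S = 2"
  shows "x S \<in> zspan G"
proof -
  have ne: "S' \<noteq> {1, 2} \<Longrightarrow> x S' \<in> zspan G" if S': "S' \<subseteq> {1..n - 1}" "card S' = 2" for S'
    using S'
  proof (cases rule: low_pair_cases)
    case (1 a)
    then show ?thesis using span_x3a by simp
  next
    case 2
    then have "S' \<subseteq> A" by (auto simp: Prs_def)
    then have "p S' + (\<Sum>a\<in>S'. x {3, a}) - e\<^sub>2 \<in> zspan G"
      using 2 by (intro zspan_intros zmod.span_sum span_x3a span_e2 zmod.span_base) (auto simp: G_def)
    then show ?thesis by (simp add: p_def)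
  next
    case 3
    have "x {3, 4} + x {3, 5} - e\<^sub>2 \<in> zspan G"
      by (intro zspan_intros span_x3a span_e2) simp_all
    then show ?thesis by (simp add: 3 e\<^sub>2_def)
  qed auto
  let ?P = "{S. S \<subseteq> {1..n - 1} \<and> card S = 2}"
  have "finite ?P" by (rule finite_subset[of _ "Pow {1..n - 1}"]) auto
  moreover have "{1, 2} \<in> ?P" using n_ge_7 by auto
  ultimately have "x {1, 2} = (\<Sum>S\<in>?P. x S) - (\<Sum>S\<in>?P - {{1, 2}}. x S)"
    using sum.remove[of ?P "{1, 2}" x] by (simp only: eq_diff_eq)
  also have "\<dots> = 3 * x {} - 2 * x {n} - (\<Sum>S\<in>?P - {{1, 2}}. x S)"
    unfolding avoid_top_pair_relation ..
  also have "\<dots> \<in> zspan G"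
  proof (intro zspan_intros zmod.span_sum)
    show "x {} \<in> zspan G" by (intro zmod.span_base) (simp add: G_def)
    show "x {n} \<in> zspan G" using n_ge_7 by (intro span_x1) auto
    show "x S \<in> zspan G" if "S \<in> ?P - {{1, 2}}" for S using ne that by blast
  qed
  finally show ?thesis using ne[OF assms] by (cases "S = {1, 2}") auto
qed

lemma span_top_pair:
  assumes "a \<in> {1..n - 1}"
  shows "x {n, a} \<in> zspan G"
proof -
  have "n \<in> {1..n} - {a}" using assms by auto
  then have "x {n, a} = (\<Sum>b\<in>{1..n} - {a}. x {b, a}) - (\<Sum>b\<in>{1..n} - {a} - {n}. x {b, a})"
    using sum.remove[of "{1..n} - {a}" n "\<lambda>b. x {b, a}"] by (simp add: eq_diff_eq add.commute)
  also have "\<dots> = 2 * x {a} - (\<Sum>b\<in>{1..n} - {a} - {n}. x {b, a})"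
    using star_relation[of "{a}"] by simp
  also have "\<dots> \<in> zspan G"
  proof (intro zspan_intros zmod.span_sum)
    show "x {a} \<in> zspan G" using assms by (intro span_x1) auto
    show "x {b, a} \<in> zspan G" if "b \<in> {1..n} - {a} - {n}" for b
      using assms that by (intro span_low_pair) auto
  qed
  finally show ?thesis .
qed

lemma span_t: "a \<in> A \<Longrightarrow> t a \<in> zspan G" and span_e3: "e\<^sub>3 \<in> zspan G"
  and span_g: "S \<in> Prs \<Longrightarrow> g S \<in> zspan G" and span_h: "T \<in> Trp \<Longrightarrow> h T \<in> zspan G"
  by (auto simp: G_def intro!: zmod.span_base)

lemma span_x3S:
  assumes S: "S \<subseteq> A" "card S = 2" "S \<noteq> {1, 2}"
  shows "x (insert 3 S) \<in> zspan G"
proof (cases "S = {4, 5}")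
  case True
  have "e\<^sub>3 + t 4 + t 5 \<in> zspan G"
    by (intro zspan_intros span_e3 span_t) simp_all
  then show ?thesis by (simp add: True e\<^sub>3_def t_def)
next
  case False
  then have "S \<in> Prs" using S by (auto simp: Prs_def)
  then have "g S + (\<Sum>a\<in>S. t a) + e\<^sub>3 \<in> zspan G"
    using S by (intro zspan_intros zmod.span_sum span_g span_t span_e3) auto
  then show ?thesis by (simp add: g_def)
qed

lemma span_x3ab: "a \<in> A \<Longrightarrow> b \<in> A \<Longrightarrow> a \<noteq> b \<Longrightarrow> {a, b} \<noteq> {1, 2} \<Longrightarrow> x {3, a, b} \<in> zspan G"
  using span_x3S[of "{a, b}"] by simp

lemma span_d:
  assumes "v \<in> A" "v \<noteq> 4" "v \<noteq> 5"
  shows "d v \<in> zspan G"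
proof -
  have "- t v - e\<^sub>3 \<in> zspan G" by (intro zspan_intros span_t span_e3 assms)
  then show ?thesis using assms by (simp add: t_def)
qed

lemma span_low_triple:
  assumes T: "T \<subseteq> {1..n - 1}" "card T = 3" "\<not> {1, 2} \<subseteq> T" "T \<noteq> {1, 4, 6}" "T \<noteq> {2, 5, 6}"
  shows "x T \<in> zspan G"
proof (cases "3 \<in> T")
  case True
  have "T - {3} \<subseteq> A" "card (T - {3}) = 2" "T - {3} \<noteq> {1, 2}" "insert 3 (T - {3}) = T"
    using T True by (auto simp: A_def)
  then show ?thesis using span_x3S[of "T - {3}"] by simp
next
  case False
  then have TA: "T \<subseteq> A" using T(1) by (auto simp: A_def)
  show ?thesis
  proof (cases "{4, 5} \<subseteq> T")
    case True
    then have "card (T - {4, 5}) = 1" using T by (simp add: card_Diff_subset)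
    then obtain v where "T - {4, 5} = {v}" by (auto simp: card_1_singleton_iff)
    then have v: "T = {4, 5, v}" "v \<noteq> 4" "v \<noteq> 5" using True by auto
    then have vA: "v \<in> A" using TA by simp
    have "d v - x {3, 4, 5} + x {3, 4, 5} + x {3, 4, v} + x {3, 5, v} \<in> zspan G"
      using v by (intro zspan_intros span_d span_x3ab vA) (auto simp: doubleton_eq_iff)
    then show ?thesis by (simp add: v d_def y_def)
  next
    case no45: False
    show ?thesis
    proof (cases "T = {2, 4, 6} \<or> T = {1, 5, 6}")
      case True
      have "d 2 + d 6 - t 4 + x {3, 2, 4} + x {3, 2, 6} + x {3, 4, 6} \<in> zspan G"
        "d 1 + d 6 - t 5 + x {3, 1, 5} + x {3, 1, 6} + x {3, 5, 6} \<in> zspan G"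
        by (intro zspan_intros span_d span_t span_x3ab; simp add: doubleton_eq_iff)+
      moreover have "d 2 + d 6 - t 4 + x {3, 2, 4} + x {3, 2, 6} + x {3, 4, 6} = x {2, 4, 6}"
        "d 1 + d 6 - t 5 + x {3, 1, 5} + x {3, 1, 6} + x {3, 5, 6} = x {1, 5, 6}"
        by (simp_all add: t_def t\<^sub>4_def t\<^sub>5_def y_def)
      ultimately show ?thesis using True by auto
    next
      case False
      then have Trp: "T \<in> Trp" using T TA no45 by (auto simp: Trp_def)
      have "T - {a} \<in> Prs" if "a \<in> T" for a
        using T no45 TA that by (auto simp: Prs_def)
      then have "h T + (\<Sum>a\<in>T. g (T - {a})) + (\<Sum>a\<in>T. t a) + e\<^sub>3 \<in> zspan G"
        using TA by (intro zspan_intros zmod.span_sum span_h Trp span_g span_t span_e3) auto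
      then show ?thesis by (simp add: h_def)
    qed
  qed
qed

abbreviation low_triples :: "nat set \<Rightarrow> nat set set" where
  "low_triples R \<equiv> {T \<in> V. n \<notin> T \<and> R \<subseteq> T}"

lemma low_triplesD: "T \<in> low_triples R \<Longrightarrow> T \<subseteq> {1..n - 1}" "T \<in> low_triples R \<Longrightarrow> card T = 3"
proof -
  assume T: "T \<in> low_triples R"
  then have "T \<subseteq> {1..n}" "n \<notin> T" "card T = 3" by (auto simp: Gamma_verts_def)
  then show "T \<subseteq> {1..n - 1}" "card T = 3" by (auto simp: subset_iff le_less)
qed

text \<open>The relation for the triples through \<open>R\<close>, reduced modulo the span: only the exceptional triples \<open>B\<close>
survive.\<close>

lemma span_low_triples_sum:
  assumes "x R \<in> zspan G" "x (insert n R) \<in> zspan G"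
    and B: "finite B" "B \<subseteq> V" "\<And>T. T \<in> B \<Longrightarrow> n \<notin> T"
    and "\<And>T. T \<in> low_triples R \<Longrightarrow> T \<notin> B \<Longrightarrow> x T \<in> zspan G"
  shows "(\<Sum>T\<in>B. of_int (of_bool (R \<subseteq> T)) * x T) \<in> zspan G"
proof -
  have fin: "finite (low_triples R)" using finite_V by simp
  have "(\<Sum>T\<in>B. of_int (of_bool (R \<subseteq> T)) * x T) = (\<Sum>T\<in>low_triples R \<inter> B. x T)"
    using B by (intro sum.mono_neutral_cong_right) auto
  also have "\<dots> = x R - x (insert n R) - (\<Sum>T\<in>low_triples R - B. x T)"
    unfolding avoid_top_relation[symmetric] using sum.Int_Diff[OF fin, of x B] by simp
  also have "\<dots> \<in> zspan G"
    using assms by (intro zspan_intros zmod.span_sum) auto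
  finally show ?thesis .
qed

text \<open>The exceptional triples are \<open>{1, 2, j}\<close>, \<open>{1, 4, 6}\<close>, \<open>{2, 5, 6}\<close>. For \<open>j\<close> beyond 6 the relation at the
point \<open>j\<close> contains just one of them. The other five are recovered from the relations for the points
2, 4, 5, 6 and for the empty set, which form a unimodular system.\<close>

lemma span_low_triples:
  assumes "T \<in> low_triples {}"
  shows "x T \<in> zspan G"
proof -
  have x1: "x {a} \<in> zspan G" "x (insert n {a}) \<in> zspan G" if "a \<in> {1..n - 1}" for a
    using that span_x1[of a] span_top_pair[of a] by auto
  have x0: "x {} \<in> zspan G" "x (insert n {}) \<in> zspan G"
    using n_ge_7 span_x1[of n] by (auto simp: G_def intro: zmod.span_base)
  have V: "{1, 2, j} \<in> V" if "j \<in> {3..n - 1}" for j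
    using that n_ge_7 by (auto simp: Gamma_verts_def)
  have V': "{1, 4, 6} \<in> V" "{2, 5, 6} \<in> V" using n_ge_7 by (auto simp: Gamma_verts_def)
  have far: "x {1, 2, j} \<in> zspan G" if j: "j \<in> {3..n - 1}" "j \<notin> {4, 5, 6}" for j
  proof -
    have "(\<Sum>T\<in>{{1, 2, j}}. of_int (of_bool ({j} \<subseteq> T)) * x T) \<in> zspan G"
    proof (rule span_low_triples_sum)
      show "x T \<in> zspan G" if "T \<in> low_triples {j}" "T \<notin> {{1, 2, j}}" for T
      proof (rule span_low_triple)
        show "T \<subseteq> {1..n - 1}" "card T = 3" using low_triplesD[OF that(1)] .
        show "\<not> {1, 2} \<subseteq> T"
        proof
          assume "{1, 2} \<subseteq> T"
          then have "{1, 2, j} = T"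
            using that j \<open>card T = 3\<close> by (intro card_subset_eq) (auto intro: card_ge_0_finite)
          then show False using that by simp
        qed
        show "T \<noteq> {1, 4, 6}" "T \<noteq> {2, 5, 6}" using that j by auto
      qed
    qed (use x1[of j] V j in auto)
    then show ?thesis by simp
  qed
  define B where "B = {{1, 2, 4}, {1, 2, 5}, {1, 2, 6}, {1, 4, 6}, {2, 5, 6 :: nat}}"
  have good: "x T \<in> zspan G" if T: "T \<in> low_triples R" "T \<notin> B" for T R
  proof (cases "{1, 2} \<subseteq> T")
    case True
    have "card (T - {1, 2}) = 1"
      using True low_triplesD[OF T(1)] by (simp add: card_Diff_subset)
    then obtain j where j: "T - {1, 2} = {j}" by (auto simp: card_1_singleton_iff)
    then have "T = {1, 2, j}" "j \<in> T" "j \<noteq> 1" "j \<noteq> 2" using True by auto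
    moreover have "j \<in> {3..n - 1}"
      using calculation low_triplesD(1)[OF T(1)] by (auto simp: subset_iff)
    ultimately show ?thesis using far[of j] T(2) by (auto simp: B_def)
  next
    case False
    then show ?thesis
      using low_triplesD[OF T(1)] T(2) by (intro span_low_triple) (auto simp: B_def)
  qed
  have BV: "finite B" "B \<subseteq> V" "\<And>T. T \<in> B \<Longrightarrow> n \<notin> T"
    using V[of 4] V[of 5] V[of 6] V' n_ge_7 unfolding B_def by auto
  have sum_B: "(\<Sum>T\<in>B. of_int (of_bool (R \<subseteq> T)) * x T) \<in> zspan G"
    if "x R \<in> zspan G" "x (insert n R) \<in> zspan G" for R
    using that BV good by (rule span_low_triples_sum)
  have B_sum: "(\<Sum>T\<in>B. F T) = F {1, 2, 4} + F {1, 2, 5} + F {1, 2, 6} + F {1, 4, 6} + F {2, 5, 6}"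
    for F :: "nat set \<Rightarrow> nat set \<Rightarrow> int"
    unfolding B_def by (simp add: set_eq_subset algebra_simps)
  let ?c = "x {1, 4, 6}" and ?d = "x {2, 5, 6}"
  have s4: "x {1, 2, 4} + ?c \<in> zspan G"
    using sum_B[OF x1, of 4] n_ge_7 unfolding B_sum by simp
  have s5: "x {1, 2, 5} + ?d \<in> zspan G"
    using sum_B[OF x1, of 5] n_ge_7 unfolding B_sum by simp
  have s6: "x {1, 2, 6} + ?c + ?d \<in> zspan G"
    using sum_B[OF x1, of 6] n_ge_7 unfolding B_sum by simp
  have s2: "x {1, 2, 4} + x {1, 2, 5} + x {1, 2, 6} + ?d \<in> zspan G"
    using sum_B[OF x1, of 2] n_ge_7 unfolding B_sum by simp
  have s0: "x {1, 2, 4} + x {1, 2, 5} + x {1, 2, 6} + ?c + ?d \<in> zspan G"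
    using sum_B[OF x0] unfolding B_sum by simp
  have "(x {1, 2, 4} + x {1, 2, 5} + x {1, 2, 6} + ?c + ?d) - (x {1, 2, 4} + x {1, 2, 5} + x {1, 2, 6} + ?d) \<in> zspan G"
    by (intro zspan_intros s0 s2)
  then have c: "?c \<in> zspan G" by simp
  have "(x {1, 2, 4} + ?c) + (x {1, 2, 5} + ?d) + (x {1, 2, 6} + ?c + ?d) - (x {1, 2, 4} + x {1, 2, 5} + x {1, 2, 6} + ?c + ?d) - ?c \<in> zspan G"
    by (intro zspan_intros s4 s5 s6 s0 c)
  then have d: "?d \<in> zspan G" by (simp add: algebra_simps)
  have "x {1, 2, 4} + ?c - ?c \<in> zspan G" "x {1, 2, 5} + ?d - ?d \<in> zspan G"
    "x {1, 2, 6} + ?c + ?d - ?c - ?d \<in> zspan G"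
    by (intro zspan_intros s4 s5 s6 c d)+
  then have "x T \<in> zspan G" if "T \<in> B" using that c d by (auto simp: B_def)
  then show ?thesis using good[OF assms] by blast
qed

lemma span_vertex:
  assumes T: "T \<in> V"
  shows "(\<lambda>U. of_bool (U = T)) \<in> zspan G"
proof -
  have "x T \<in> zspan G"
  proof (cases "n \<in> T")
    case False
    then show ?thesis using T by (intro span_low_triples) simp
  next
    case True
    let ?R = "T - {n}"
    have R: "?R \<subseteq> {1..n - 1}" "card ?R = 2" "insert n ?R = T"
      using T True vertexD[OF T] by (auto simp: subset_iff)
    have "x T = x ?R - (\<Sum>U\<in>low_triples ?R. x U)"
      unfolding avoid_top_relation R(3) by simp
    also have "\<dots> \<in> zspan G"
      using R by (intro zspan_intros zmod.span_sum span_low_pair span_low_triples) auto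
    finally show ?thesis .
  qed
  then show ?thesis by (simp add: x_vertex[OF T])
qed

section \<open>Multiplicities and the diagonal form\<close>

lemma card_A: "card A = n - 2"
  using n_ge_7 by (simp add: A_def)

lemma finite_Prs: "finite Prs"
  by (rule finite_subset[of _ "Pow A"]) (auto simp: Prs_def)

lemma finite_Trp: "finite Trp"
  by (rule finite_subset[of _ "Pow A"]) (unfold Trp_def, blast, simp)

lemma card_Prs: "int (card Prs) = int (n choose 2) - 2 * int n + 1"
proof -
  have fin: "finite {S. S \<subseteq> A \<and> card S = 2}" by (rule finite_subset[of _ "Pow A"]) auto
  obtain m where m: "n = m + 2" using n_ge_7 that[of "n - 2"] by simp
  have "{{1, 2}, {4, 5}} \<subseteq> {S. S \<subseteq> A \<and> card S = 2}" by auto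
  then have "card Prs + 2 = card {S. S \<subseteq> A \<and> card S = 2}"
    using card_mono[OF fin, of "{{1, 2}, {4, 5}}"]
    unfolding Prs_def by (subst card_Diff_subset) (auto simp: set_eq_subset)
  also have "\<dots> = (n - 2) choose 2"
    by (simp add: n_subsets card_A)
  finally show ?thesis
    by (simp add: m numeral_eq_Suc)
qed

text \<open>Such a triple is fixed by its third point in \<open>A - {a, b}\<close>.\<close>

lemma card_triples_containing:
  assumes "a \<in> A" "b \<in> A" "a \<noteq> b"
  shows "card {T. T \<subseteq> A \<and> card T = 3 \<and> {a, b} \<subseteq> T} = n - 4"
proof -
  have "bij_betw (\<lambda>c. {a, b, c}) (A - {a, b}) {T. T \<subseteq> A \<and> card T = 3 \<and> {a, b} \<subseteq> T}"
    unfolding bij_betw_def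
  proof
    show "inj_on (\<lambda>c. {a, b, c}) (A - {a, b})" by (auto simp: inj_on_def)
    show "(\<lambda>c. {a, b, c}) ` (A - {a, b}) = {T. T \<subseteq> A \<and> card T = 3 \<and> {a, b} \<subseteq> T}"
    proof (intro equalityI subsetI)
      fix T assume T: "T \<in> {T. T \<subseteq> A \<and> card T = 3 \<and> {a, b} \<subseteq> T}"
      then have "card (T - {a, b}) = 1" using assms by (simp add: card_Diff_subset)
      then obtain c where c: "T - {a, b} = {c}" by (auto simp: card_1_singleton_iff)
      then have "T = {a, b, c}" "c \<in> A - {a, b}" using T by auto
      then show "T \<in> (\<lambda>c. {a, b, c}) ` (A - {a, b})" by blast
    qed (use assms in auto)
  qed
  then have "card {T. T \<subseteq> A \<and> card T = 3 \<and> {a, b} \<subseteq> T} = card (A - {a, b})"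
    by (simp add: bij_betw_same_card)
  then show ?thesis using assms by (simp add: card_Diff_subset card_A)
qed

text \<open>The triples removed from the \<open>n - 2\<close> over 3 subsets of \<open>A\<close> are \<open>n - 4\<close> through \<open>{1, 2}\<close>, \<open>n - 4\<close> through
\<open>{4, 5}\<close>, and four more.\<close>

lemma card_Trp: "int (card Trp) = int (n choose 3) - 2 * int (n choose 2) + int n"
proof -
  let ?P = "{T. T \<subseteq> A \<and> card T = 3}"
  let ?X = "{T. T \<subseteq> A \<and> card T = 3 \<and> {1, 2} \<subseteq> T}"
  let ?Y = "{T. T \<subseteq> A \<and> card T = 3 \<and> {4, 5} \<subseteq> T}"
  let ?Z = "{{1, 4, 6}, {1, 5, 6}, {2, 4, 6}, {2, 5, 6 :: nat}}"
  obtain m where m: "n = m + 2" using n_ge_7 that[of "n - 2"] by simp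
  have fin: "finite ?P" by (rule finite_subset[of _ "Pow A"]) auto
  have finXY: "finite ?X" "finite ?Y" by (rule finite_subset[OF _ fin]; blast)+
  have "?X \<inter> ?Y = {}"
  proof -
    have False if "T \<subseteq> A" "card T = 3" "{1, 2} \<subseteq> T" "{4, 5} \<subseteq> T" for T
    proof -
      have "card {1, 2, 4, 5 :: nat} \<le> card T"
        using that finite_subset[OF that(1)] by (intro card_mono) auto
      then show False using that by simp
    qed
    then show ?thesis by blast
  qed
  moreover have "?Z \<subseteq> ?P" by auto
  moreover have "(?X \<union> ?Y) \<inter> ?Z = {}" by auto
  moreover have "card ?Z = 4" by (simp add: set_eq_subset)
  moreover have "card ?X = n - 4" "card ?Y = n - 4"
    by (rule card_triples_containing; simp)+
  ultimately have "card (?X \<union> ?Y \<union> ?Z) = 2 * (n - 4) + 4"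
    using card_Un_disjoint[of ?X ?Y] card_Un_disjoint[of "?X \<union> ?Y" ?Z] finXY
    by (simp only: finite_Un finite.emptyI finite_insert mult_2)
  moreover have "?X \<union> ?Y \<union> ?Z \<subseteq> ?P" using \<open>?Z \<subseteq> ?P\<close> by blast
  moreover have "Trp = ?P - (?X \<union> ?Y \<union> ?Z)"
    unfolding Trp_def by blast
  ultimately have "card Trp = card ?P - (2 * (n - 4) + 4)" "2 * (n - 4) + 4 \<le> card ?P"
    using card_mono[OF fin, of "?X \<union> ?Y \<union> ?Z"] finXY
    by (simp_all add: card_Diff_subset)
  moreover have "card ?P = (n - 2) choose 3"
    by (simp add: n_subsets card_A)
  moreover have "int (n choose 3) = int ((n - 2) choose 3) + 2 * int ((n - 2) choose 2) + int (n - 2)"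
    "int (n choose 2) = int ((n - 2) choose 2) + 2 * int (n - 2) + 1"
    by (simp_all add: m numeral_eq_Suc)
  ultimately show ?thesis
    using n_ge_7 by (simp add: of_nat_diff)
qed

lemma sum_const_mset: "finite I \<Longrightarrow> (\<Sum>i\<in>I. M) = repeat_mset (card I) M"
  by (induction I rule: finite_induct) (simp_all add: repeat_mset_distrib)

text \<open>The contribution of the three-term chain of one point of \<open>A\<close>.\<close>

definition R_diag :: "int multiset" where
  "R_diag = (if odd n then {#1, 1, 6 * (int n - 2) * (int n - 1) * int n#}
     else {#2, 2, 3 * (int n - 2) * (int n - 1) * int n div 2#})"

lemma has_diagonal_R:
  assumes "a \<in> A"
  shows "has_diagonal Lap {t a, q a, r a} R_diag"
proof (cases "odd n")
  case True
  have "has_diagonal Lap {t a, q a, r a} {#1, 1, int n * (2 * (int n - 1)) * (3 * (int n - 2))#}"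
    by (rule has_diagonal_chain3_odd[OF additive_Lap Lap_t[OF assms] Lap_q[OF assms] Lap_r[OF assms]])
      (use True in simp_all)
  then show ?thesis using True by (simp add: R_diag_def algebra_simps)
next
  case False
  then obtain k where k: "n = 2 * k" by (auto elim: evenE)
  have "has_diagonal Lap {t a, q a, r a} {#2, 2, 2 * int k * (int n - 1) * (3 * (int k - 1))#}"
  proof (rule has_diagonal_chain3_even[OF additive_Lap])
    show "Lap (t a) = 2 * q a - of_int (2 * (3 * (int k - 1))) * t a"
    proof -
      have "2 * (3 * (int k - 1)) = 3 * (int n - 2)" by (simp add: k)
      then show ?thesis by (simp only: Lap_t[OF assms])
    qed
    show "Lap (q a) = 2 * r a - of_int (2 * (int n - 1)) * q a"
      by (rule Lap_q[OF assms])
    show "Lap (r a) = - (of_int (2 * int k) * r a)"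
      using Lap_r[OF assms] by (simp add: k)
  qed
  moreover have "3 * (int n - 2) * (int n - 1) * int n = 2 * (2 * int k * (int n - 1) * (3 * (int k - 1)))"
    by (simp add: k algebra_simps)
  then have "3 * (int n - 2) * (int n - 1) * int n div 2 = 2 * int k * (int n - 1) * (3 * (int k - 1))"
    by (simp only: nonzero_mult_div_cancel_left)
  ultimately show ?thesis using False by (simp only: R_diag_def if_False)
qed

lemma has_diagonal_core:
  "has_diagonal Lap {e\<^sub>3, e\<^sub>2, x {3}, x {}} (if n mod 3 = 2 then {#36, 1, 1, 0#} else {#12, 3, 1, 0#})"
proof -
  obtain k where k: "n = k + 3" using n_ge_7 that[of "n - 3"] by simp
  have two: "2 * (m + 2 choose 2) = (m + 2) * (m + 1)" for m :: nat
    by (induction m) (simp_all add: numeral_eq_Suc)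
  have three: "3 * (m + 3 choose 3) = (m + 3) * (m + 2 choose 2)" for m :: nat
    using Suc_times_binomial_eq[of "m + 2" 2] by (simp add: numeral_eq_Suc)
  have "2 * int (k + 2 choose 2) = (int n - 1) * (int n - 2)"
    using arg_cong[OF two[of k], of int] by (simp add: k algebra_simps)
  moreover have "3 * int (k + 3 choose 3) = int n * int (k + 2 choose 2)"
    using arg_cong[OF three[of k], of int] by (simp add: k algebra_simps)
  ultimately have "has_diagonal Lap {e\<^sub>3, e\<^sub>2, x {3}, x {}}
      (if int n mod 3 = 2 then {#36, 1, 1, 0#} else {#12, 3, 1, 0#})"
    by (rule has_diagonal_chain4[OF additive_Lap Lap_e3 Lap_e2 Lap_e1 Lap_empty])
  moreover have "int n mod 3 = 2 \<longleftrightarrow> n mod 3 = 2" by presburger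
  ultimately show ?thesis by simp
qed

lemma has_diagonal_Lap:
  "has_diagonal Lap G
    ((if n mod 3 = 2 then {#36, 1, 1, 0#} else {#12, 3, 1, 0#})
    + repeat_mset (n - 2) R_diag
    + repeat_mset (card Prs) {#1, 6 * (int n - 2) * (int n - 1)#}
    + repeat_mset (card Trp) {#3 * (int n - 2)#})"
proof -
  have "has_diagonal Lap {g S, p S} {#1, 6 * (int n - 2) * (int n - 1)#}" if "S \<in> Prs" for S
  proof -
    have "S \<subseteq> A" "card S = 2" using that by (auto simp: Prs_def)
    note chain = has_diagonal_chain2[OF additive_Lap Lap_g[OF this] Lap_p[OF this]]
    have "2 * (int n - 1) * (3 * (int n - 2)) = 6 * (int n - 2) * (int n - 1)"
      by (simp add: algebra_simps)
    then show ?thesis using chain by (simp only:)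
  qed
  moreover have "has_diagonal Lap {h T} {#3 * (int n - 2)#}" if "T \<in> Trp" for T
    using that by (intro has_diagonal_eigenvector Lap_h) (auto simp: Trp_def)
  ultimately show ?thesis
    unfolding G_def card_A[symmetric] sum_const_mset[OF finite_A, symmetric]
      sum_const_mset[OF finite_Prs, symmetric] sum_const_mset[OF finite_Trp, symmetric]
    by (intro has_diagonal_Un has_diagonal_UN has_diagonal_core has_diagonal_R
        finite_A finite_Prs finite_Trp)
qed

end

theorem theorem5p6:
  fixes n :: nat and vs :: "nat set list"
  assumes "n \<ge> 7" and "Gamma_enum n 3 vs"
  shows "\<exists>D. diagonal_form (johnson3_laplacian n vs) D \<and>
    mset (diag_mat D) =
      replicate_mset (nat (int (n choose 3) - 2 * int (n choose 2) + int n)) (3 * (int n - 2))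
    + replicate_mset (nat (int (n choose 2) - 2 * int n + 1)) (6 * (int n - 2) * (int n - 1))
    + replicate_mset (nat (int (n choose 2) - 2 * int n + 2)) 1
    + (if odd n
       then replicate_mset (n - 2) (6 * (int n - 2) * (int n - 1) * int n)
          + replicate_mset (2 * (n - 2)) 1
       else replicate_mset (n - 2) (3 * (int n - 2) * (int n - 1) * int n div 2)
          + replicate_mset (2 * (n - 2)) 2)
    + (if n mod 3 = 2
       then replicate_mset 1 36 + replicate_mset 1 1
       else replicate_mset 1 12 + replicate_mset 1 3)
    + replicate_mset 1 0"
proof -
  interpret johnson n by standard fact
  have vs: "distinct vs" "set vs = V" using assms(2) by (auto simp: Gamma_enum_def)
  define Ds where "Ds = (if n mod 3 = 2 then {#36, 1, 1, 0#} else {#12, 3, 1, 0#})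
    + repeat_mset (n - 2) R_diag
    + repeat_mset (card Prs) {#1, 6 * (int n - 2) * (int n - 1)#}
    + repeat_mset (card Trp) {#3 * (int n - 2)#}"
  define K where "K S T = (if Gamma_adj n 3 2 S T then 1 else 0)
    - 3 * (int n - 3) * (if S = T then 1 else 0)" for S T
  have "length vs = card V" using vs distinct_card by metis
  also have "\<dots> = n choose 3" by (simp add: Gamma_verts_def n_subsets)
  finally have len: "length vs = n choose 3" .
  have "int (size Ds) = int (n choose 3)"
    using card_Prs card_Trp n_ge_7 by (simp add: Ds_def R_diag_def)
  then have size: "size Ds = length vs" by (simp add: len)
  have "Lap f S = (\<Sum>T\<in>set vs. K S T * f T)" if "S \<in> set vs" for f S
  proof -
    have "(\<Sum>T\<in>set vs. K S T * f T)
        = (\<Sum>T\<in>V. if Gamma_adj n 3 2 S T then f T else 0) - 3 * (int n - 3) * (\<Sum>T\<in>V. if S = T then f T else 0)"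
      unfolding vs K_def sum_distrib_left sum_subtractf[symmetric]
      by (intro sum.cong refl) (simp add: algebra_simps)
    also have "(\<Sum>T\<in>V. if Gamma_adj n 3 2 S T then f T else 0) = (\<Sum>T | Gamma_adj n 3 2 S T. f T)"
      using finite_V by (intro sum.mono_neutral_cong_right) (auto simp: Gamma_adj_def)
    also have "(\<Sum>T\<in>V. if S = T then f T else 0) = f S"
      using finite_V that vs by simp
    finally show ?thesis using that vs by (simp add: Lap_def)
  qed
  then have "\<exists>D. diagonal_form (mat (length vs) (length vs) (\<lambda>(i, j). K (vs ! i) (vs ! j))) D
      \<and> mset (diag_mat D) = Ds"
    using vs span_vertex
    by (intro diagonal_form_if_has_diagonal[OF vs(1) size has_diagonal_Lap[folded Ds_def]]) auto
  moreover have "mat (length vs) (length vs) (\<lambda>(i, j). K (vs ! i) (vs ! j)) = johnson3_laplacian n vs"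
    using vs(1)
    by (intro eq_matI) (auto simp: K_def johnson3_laplacian_def Gamma_adj_mat_def nth_eq_iff_index_eq)
  moreover have "Ds = replicate_mset (nat (int (n choose 3) - 2 * int (n choose 2) + int n)) (3 * (int n - 2))
    + replicate_mset (nat (int (n choose 2) - 2 * int n + 1)) (6 * (int n - 2) * (int n - 1))
    + replicate_mset (nat (int (n choose 2) - 2 * int n + 2)) 1
    + (if odd n
       then replicate_mset (n - 2) (6 * (int n - 2) * (int n - 1) * int n)
          + replicate_mset (2 * (n - 2)) 1
       else replicate_mset (n - 2) (3 * (int n - 2) * (int n - 1) * int n div 2)
          + replicate_mset (2 * (n - 2)) 2)
    + (if n mod 3 = 2
       then replicate_mset 1 36 + replicate_mset 1 1
       else replicate_mset 1 12 + replicate_mset 1 3)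
    + replicate_mset 1 0"
  proof -
    have "nat (int (n choose 2) - 2 * int n + 2) = Suc (card Prs)"
      "nat (int (n choose 2) - 2 * int n + 1) = card Prs"
      "nat (int (n choose 3) - 2 * int (n choose 2) + int n) = card Trp"
      using card_Prs card_Trp by linarith+
    moreover have "replicate_mset k z + replicate_mset k z = replicate_mset (2 * k) z" for k and z :: int
      by (rule multiset_eqI) simp
    ultimately show ?thesis
      by (simp add: Ds_def R_diag_def)
  qed
  ultimately show ?thesis by simp
qed

end
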